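(* Let $\mathscr{C}$ be a positive variety. Then the covering problem for the class $(\mathscr{C}\circ\mathsf{SU})\circ\mathsf{MOD}$ can be effectively reduced to the covering problem for the class $\mathscr{C}\circ\mathsf{SU}$. Likewise, the separation problem for $(\mathscr{C}\circ\mathsf{SU})\circ\mathsf{MOD}$ can be effectively reduced to the separation problem for $\mathscr{C}\circ\mathsf{SU}$.
   Context: A class of languages $\mathscr{C}$ assigns to every finite alphabet $A$ a set $\mathscr{C}(A)$ of regular languages over $A$. It is a lattice if each $\mathscr{C}(A)$ contains $\emptyset$ and $A^*$ and is closed under finite unions and intersections; it is quotient-closed if for all $L\in\mathscr{C}(A)$ and $u\in A^*$, the languages $u^{-1}L=\{v\mid uv\in L\}$ and $Lu^{-1}=\{v\mid vu\in L\}$ are in $\mathscr{C}(A)$. A positive variety is a quotient-closed lattice closed under inverse images of all monoid morphisms $\alpha:A^*\to B^*$ (i.e. $L\in\mathscr{C}(B)\Rightarrow \alpha^{-1}(L)\in\mathscr{C}(A)$). Enrichment: for a finite partition $\mathbf{P}$ of $A^*$ and $u\in A^*$, let $[u]_{\mathbf{P}}$ be the block of $\mathbf{P}$ containing $u$. The $\mathbf{P}$-tagging $\tau_{\mathbf{P}}:A^*\to(\mathbf{P}\times A)^*$ is defined by $\tau_{\mathbf{P}}(\varepsilon)=\varepsilon$ and $\tau_{\mathbf{P}}(a_1\cdots a_n)=b_1\cdots b_n$ with $b_i=([a_1\cdots a_{i-1}]_{\mathbf{P}},a_i)$ (so $b_1=([\varepsilon]_{\mathbf{P}},a_1)$). A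 language $L\subseteq A^*$ is $\mathbf{P}$-liftable from $\mathscr{C}$ if there are $L_P\in\mathscr{C}(\mathbf{P}\times A)$ for $P\in\mathbf{P}$ with $L=\bigcup_{P\in\mathbf{P}}(\tau_{\mathbf{P}}^{-1}(L_P)\cap P)$. For classes $\mathscr{C},\mathscr{D}$, a $\mathscr{D}$-partition of $A^*$ is a finite partition of $A^*$ into languages of $\mathscr{D}(A)$, and $(\mathscr{C}\circ\mathscr{D})(A)$ is the set of languages $L\subseteq A^*$ that are $\mathbf{P}$-liftable from $\mathscr{C}$ for some $\mathscr{D}$-partition $\mathbf{P}$ of $A^*$. $\mathsf{MOD}(A)$ is the set of finite Boolean combinations of languages $\{w\in A^*\mid |w|\equiv m \bmod d\}$ ($m,d\in\mathbb{N}$, $m<d$). $\mathsf{SU}(A)$ is the set of finite Boolean combinations of languages $A^*w$ with $w\in A^*$. Covering and separation: for a class $\mathscr{C}$, a language $L_1\subseteq A^*$ and a finite multiset $\mathbf{L}_2$ of languages over $A$, the pair $(L_1,\mathbf{L}_2)$ is $\mathscr{C}$-coverable if there is a finite set $\mathbf{K}\subseteq\mathscr{C}(A)$ with $L_1\subseteq\bigcup_{K\in\mathbf{K}}K$ such that every $K\in\mathbf{K}$ is disjoint from some $L\in\mathbf{L}_2$. The $\mathscr{C}$-covering problem takes as input a regular $L_1$ and a finite multiset of regular languages $\mathbf{L}_2$ and asks whether $(L_1,\mathbf{L}_2)$ is $\mathscr{C}$-coverable. $L_1$ is $\mathscr{C}$-separable from $L_2$ if some $K\in\mathscr{C}(A)$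 satisfies $L_1\subseteq K$ and $K\cap L_2=\emptyset$; the $\mathscr{C}$-separation problem takes two regular languages and asks this. *)

theory Defs
  imports Main "HOL-Library.Multiset" "HOL-Library.Disjoint_Sets" "HOL-Library.Nat_Bijection"
begin

section \<open>Regular languages\<close>

text \<open>
  Alphabets of classes of languages and of problem inputs are finite sets of natural numbers, so
  that automata are finite data on which computability makes sense.  Every finite alphabet is a
  renaming of such a set; other letter types are handled by \<open>at_alphabet\<close> below.
\<close>

text \<open>
  Nondeterministic automata; every triple of lists is a valid automaton, and its states
  are the numbers that occur in it.  A transition is a triple (source, letter, target).
\<close>

datatype nfa =
  NFA (initial: "nat list") (transitions: "(nat \<times> nat \<times> nat) list") (final: "nat list")

primrec nfa_steps :: "nfa \<Rightarrow> nat set \<Rightarrow> nat list \<Rightarrow> nat set" where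
  "nfa_steps N Q [] = Q"
| "nfa_steps N Q (a # w) = nfa_steps N {q'. \<exists>q\<in>Q. (q, a, q') \<in> set (transitions N)} w"

definition nfa_lang :: "nat set \<Rightarrow> nfa \<Rightarrow> nat list set" where
  "nfa_lang A N = {w \<in> lists A. nfa_steps N (set (initial N)) w \<inter> set (final N) \<noteq> {}}"

definition regular :: "nat set \<Rightarrow> nat list set \<Rightarrow> bool" where
  "regular A L \<longleftrightarrow> (\<exists>N. L = nfa_lang A N)"


section \<open>Classes of languages\<close>

type_synonym lang_class = "nat set \<Rightarrow> nat list set set"

text \<open>Only the values of a class on finite alphabets are meaningful.\<close>

definition is_class :: "lang_class \<Rightarrow> bool" where
  "is_class C \<longleftrightarrow> (\<forall>A. finite A \<longrightarrow> (\<forall>L\<in>C A. regular A L))"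

definition is_lattice :: "lang_class \<Rightarrow> bool" where
  "is_lattice C \<longleftrightarrow> (\<forall>A. finite A \<longrightarrow>
     {} \<in> C A \<and> lists A \<in> C A \<and> (\<forall>K\<in>C A. \<forall>L\<in>C A. K \<union> L \<in> C A \<and> K \<inter> L \<in> C A))"

definition quotient_closed :: "lang_class \<Rightarrow> bool" where
  "quotient_closed C \<longleftrightarrow> (\<forall>A. finite A \<longrightarrow> (\<forall>L\<in>C A. \<forall>u\<in>lists A.
     {v \<in> lists A. u @ v \<in> L} \<in> C A \<and> {v \<in> lists A. v @ u \<in> L} \<in> C A))"

definition word_morphism :: "nat set \<Rightarrow> nat set \<Rightarrow> (nat list \<Rightarrow> nat list) \<Rightarrow> bool" where
  "word_morphism A B h \<longleftrightarrow> (\<forall>u\<in>lists A. h u \<in> lists B) \<and> h [] = [] \<and>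
     (\<forall>u\<in>lists A. \<forall>v\<in>lists A. h (u @ v) = h u @ h v)"

definition inverse_morphism_closed :: "lang_class \<Rightarrow> bool" where
  "inverse_morphism_closed C \<longleftrightarrow> (\<forall>A B h. finite A \<longrightarrow> finite B \<longrightarrow> word_morphism A B h \<longrightarrow>
     (\<forall>L\<in>C B. {w \<in> lists A. h w \<in> L} \<in> C A))"

definition positive_variety :: "lang_class \<Rightarrow> bool" where
  "positive_variety C \<longleftrightarrow>
     is_class C \<and> is_lattice C \<and> quotient_closed C \<and> inverse_morphism_closed C"

inductive_set boolean_combinations :: "nat set \<Rightarrow> nat list set set \<Rightarrow> nat list set set"
  for A G where
  gen: "L \<in> G \<Longrightarrow> L \<in> boolean_combinations A G"
| un: "K \<in> boolean_combinations A G \<Longrightarrow> L \<in> boolean_combinations A G \<Longrightarrow>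
    K \<union> L \<in> boolean_combinations A G"
| int: "K \<in> boolean_combinations A G \<Longrightarrow> L \<in> boolean_combinations A G \<Longrightarrow>
    K \<inter> L \<in> boolean_combinations A G"
| compl: "L \<in> boolean_combinations A G \<Longrightarrow> lists A - L \<in> boolean_combinations A G"

definition MOD :: lang_class where
  "MOD A = boolean_combinations A {{w \<in> lists A. length w mod d = m} | m d. m < d}"

definition SU :: lang_class where
  "SU A = boolean_combinations A {{v @ w | v. v \<in> lists A} | w. w \<in> lists A}"


section \<open>Enrichment\<close>

text \<open>
  The value of a class on a finite alphabet with letters of an arbitrary type, obtained by numbering
  the letters.  The choice of the numbering is immaterial for classes that are
  invariant under bijective renaming of letters, such as positive varieties
  (see \<open>at_alphabet_nat\<close>).
\<close>

definition at_alphabet :: "lang_class \<Rightarrow> 'a set \<Rightarrow> 'a list set set" where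
  "at_alphabet C A =
     {L. L \<subseteq> lists A \<and> (\<exists>e. inj_on e A \<and> map e ` L \<in> C (e ` A))}"

definition block :: "'a list set set \<Rightarrow> 'a list \<Rightarrow> 'a list set" where
  "block P u = (THE B. B \<in> P \<and> u \<in> B)"

definition tagging :: "'a list set set \<Rightarrow> 'a list \<Rightarrow> ('a list set \<times> 'a) list" where
  "tagging P w = map (\<lambda>i. (block P (take i w), w ! i)) [0..<length w]"

definition liftable :: "lang_class \<Rightarrow> nat set \<Rightarrow> nat list set set \<Rightarrow> nat list set \<Rightarrow> bool" where
  "liftable C A P L \<longleftrightarrow> (\<exists>F. (\<forall>B\<in>P. F B \<in> at_alphabet C (P \<times> A)) \<and>
     L = (\<Union>B\<in>P. {w \<in> lists A. tagging P w \<in> F B} \<inter> B))"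

definition enrich :: "lang_class \<Rightarrow> lang_class \<Rightarrow> lang_class" (infixl "\<circ>\<^sub>e" 70) where
  "(C \<circ>\<^sub>e D) A = {L. \<exists>P. finite P \<and> partition_on (lists A) P \<and> P \<subseteq> D A \<and> liftable C A P L}"


section \<open>Covering and separation\<close>

definition coverable :: "lang_class \<Rightarrow> nat set \<Rightarrow> nat list set \<Rightarrow> nat list set multiset \<Rightarrow> bool" where
  "coverable C A L1 L2s \<longleftrightarrow> (\<exists>\<K>. finite \<K> \<and> \<K> \<subseteq> C A \<and> L1 \<subseteq> \<Union>\<K> \<and>
     (\<forall>K\<in>\<K>. \<exists>L\<in>#L2s. K \<inter> L = {}))"

definition separable :: "lang_class \<Rightarrow> nat set \<Rightarrow> nat list set \<Rightarrow> nat list set \<Rightarrow> bool" where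
  "separable C A L1 L2 \<longleftrightarrow> (\<exists>K\<in>C A. L1 \<subseteq> K \<and> K \<inter> L2 = {})"

text \<open>
  Inputs of the decision problems: an alphabet together with automata over it
  (transitions on letters outside the alphabet are ignored by \<open>nfa_lang\<close>).
\<close>

type_synonym covering_input = "nat list \<times> nfa \<times> nfa list"
type_synonym separation_input = "nat list \<times> nfa \<times> nfa"

fun covering_problem :: "lang_class \<Rightarrow> covering_input \<Rightarrow> bool" where
  "covering_problem C (A, N, Ns) \<longleftrightarrow>
     coverable C (set A) (nfa_lang (set A) N) (mset (map (nfa_lang (set A)) Ns))"

fun separation_problem :: "lang_class \<Rightarrow> separation_input \<Rightarrow> bool" where
  "separation_problem C (A, N1, N2) \<longleftrightarrow>
     separable C (set A) (nfa_lang (set A) N1) (nfa_lang (set A) N2)"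


section \<open>Effective reductions\<close>

text \<open>Partial recursive functions, with programs and their graph semantics.\<close>

datatype recf =
  Zero | Succ | Proj nat | Comp recf "recf list" | Prim recf recf | Mu recf

inductive recf_eval :: "recf \<Rightarrow> nat list \<Rightarrow> nat \<Rightarrow> bool" where
  zero: "recf_eval Zero xs 0"
| succ: "recf_eval Succ [x] (Suc x)"
| proj: "i < length xs \<Longrightarrow> recf_eval (Proj i) xs (xs ! i)"
| comp: "list_all2 (\<lambda>g y. recf_eval g xs y) gs ys \<Longrightarrow> recf_eval f ys z \<Longrightarrow>
    recf_eval (Comp f gs) xs z"
| prim_0: "recf_eval f xs y \<Longrightarrow> recf_eval (Prim f g) (0 # xs) y"
| prim_Suc: "recf_eval (Prim f g) (n # xs) r \<Longrightarrow> recf_eval g (n # r # xs) y \<Longrightarrow>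
    recf_eval (Prim f g) (Suc n # xs) y"
| mu: "recf_eval f (n # xs) 0 \<Longrightarrow> \<forall>m<n. \<exists>y>0. recf_eval f (m # xs) y \<Longrightarrow>
    recf_eval (Mu f) xs n"

definition total_recursive :: "(nat \<Rightarrow> nat) \<Rightarrow> bool" where
  "total_recursive g \<longleftrightarrow> (\<exists>r. \<forall>x. recf_eval r [x] (g x))"

text \<open>
  Computable many-one reducibility between problems whose inputs are coded
  by natural numbers.
\<close>

definition effectively_reduces :: "('i \<Rightarrow> nat) \<Rightarrow> ('i \<Rightarrow> bool) \<Rightarrow> ('i \<Rightarrow> bool) \<Rightarrow> bool" where
  "effectively_reduces code P Q \<longleftrightarrow> (\<exists>f g. total_recursive g \<and>
     (\<forall>x. g (code x) = code (f x)) \<and> (\<forall>x. P x \<longleftrightarrow> Q (f x)))"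

fun triple_code :: "nat \<times> nat \<times> nat \<Rightarrow> nat" where
  "triple_code (x, y, z) = prod_encode (x, prod_encode (y, z))"

fun nfa_code :: "nfa \<Rightarrow> nat" where
  "nfa_code (NFA I T F) =
     triple_code (list_encode I, list_encode (map triple_code T), list_encode F)"

fun covering_code :: "covering_input \<Rightarrow> nat" where
  "covering_code (A, N, Ns) =
     triple_code (list_encode A, nfa_code N, list_encode (map nfa_code Ns))"

fun separation_code :: "separation_input \<Rightarrow> nat" where
  "separation_code (A, N1, N2) = triple_code (list_encode A, nfa_code N1, nfa_code N2)"


section \<open>Consistency of the encodings\<close>

lemma inj_triple_code: "inj triple_code"
  by (rule injI) (auto simp: prod_encode_eq)

lemma inj_nfa_code: "inj nfa_code"
proof (rule injI)
  fix M N assume "nfa_code M = nfa_code N"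
  then show "M = N"
    by (cases M; cases N) (auto simp: prod_encode_eq list_encode_eq inj_map_eq_map[OF inj_triple_code])
qed

lemma inj_covering_code: "inj covering_code"
  by (rule injI)
    (auto simp: prod_encode_eq list_encode_eq inj_map_eq_map[OF inj_nfa_code]
      inj_eq[OF inj_nfa_code])

lemma inj_separation_code: "inj separation_code"
  by (rule injI) (auto simp: prod_encode_eq list_encode_eq inj_eq[OF inj_nfa_code])

lemma at_alphabet_nat:
  assumes C: "positive_variety C" and A: "finite A"
  shows "at_alphabet C A = C A"
proof
  show "at_alphabet C A \<subseteq> C A"
  proof
    fix L assume "L \<in> at_alphabet C A"
    then obtain e where L: "L \<subseteq> lists A" and e: "inj_on e A" "map e ` L \<in> C (e ` A)"
      by (auto simp: at_alphabet_def)
    have "word_morphism A (e ` A) (map e)"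
      by (auto simp: word_morphism_def)
    then have "{w \<in> lists A. map e w \<in> map e ` L} \<in> C A"
      using C A e unfolding positive_variety_def inverse_morphism_closed_def by blast
    moreover have "{w \<in> lists A. map e w \<in> map e ` L} = L"
    proof -
      have "inj_on (map e) (lists A)"
        by (rule inj_on_mapI, rule inj_on_subset[OF e(1)]) auto
      then show ?thesis
        using L inj_on_image_mem_iff[of "map e" "lists A" _ L] by blast
    qed
    ultimately show "L \<in> C A" by simp
  qed
next
  show "C A \<subseteq> at_alphabet C A"
  proof
    fix L assume L: "L \<in> C A"
    then have "L \<subseteq> lists A"
      using C A by (auto simp: positive_variety_def is_class_def regular_def nfa_lang_def)
    with L show "L \<in> at_alphabet C A"
      by (auto simp: at_alphabet_def intro!: exI[of _ id])
  qed
qed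

end

theory Submission
  imports Defs
begin

text \<open>
  Let \<open>\<D> = C \<circ>\<^sub>e SU\<close>. A language in \<open>\<D> \<circ>\<^sub>e MOD\<close> reads a word together with its positions modulo some \<open>d\<close>.
  For given automata there is a computable \<open>s\<close> such that every word of length \<open>s\<close> acts on the states like
  some word of length \<open>s * c\<close>, for each \<open>c > 0\<close>: the sets of actions of the words of length \<open>n\<close> are
  the iterates of a map on a finite set, so the factorial of its size will do. Replacing the
  blocks of length \<open>s\<close> of a word by such words of length \<open>d = s * c\<close> keeps the word in the given languages, and
  it turns positions modulo \<open>s\<close> into positions modulo \<open>d\<close>. This replacement is a morphism up to a
  bounded left context and an unfinished last block; the context is absorbed by \<open>SU\<close> and the
  last block by a quotient. Hence \<open>\<D> \<circ>\<^sub>e MOD\<close> separates or covers if and only if \<open>\<D>\<close> does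
  so after tagging the positions modulo \<open>s\<close>, and automata for the tagged languages are
  computed from the given ones.
\<close>

section \<open>Recursive functions\<close>

text \<open>The modulus of a separator or cover is not known to the reduction; this is why
  \<open>s\<close> has to serve all its multiples at once, and why the reduction does not depend on
  \<open>C\<close>. The direction from \<open>\<D>\<close> back to
  \<open>\<D> \<circ>\<^sub>e MOD\<close> is easy, since inverse images under the tagging modulo
  \<open>s\<close> lie in the larger class. The obstacle is the other direction: the
  \<open>SU\<close> tags of the substituted word look back over output produced by earlier blocks.
  The tags modulo \<open>s\<close> carried by the input mark the block boundaries, so a window of
  \<open>s * Suc k\<close> tagged letters reveals both the unfinished block and the last
  \<open>k\<close> letters of finished output. Partitions are replaced by functions with finitely
  many numerical values, because problem inputs have numerical letters and because two layers of
  tags are nested. The bound on states and on the number of automata is read off from the code of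
  the input itself. The resulting \<open>s\<close> is enormous, but only computability is asked
  for.\<close>

lemma recf_eval_Comp1:
  "recf_eval g xs y \<Longrightarrow> recf_eval f [y] z \<Longrightarrow> recf_eval (Comp f [g]) xs z"
  by (rule recf_eval.comp[where ys = "[y]"]) auto

lemma recf_eval_Comp2:
  "recf_eval g xs y \<Longrightarrow> recf_eval g' xs y' \<Longrightarrow> recf_eval f [y, y'] z \<Longrightarrow>
    recf_eval (Comp f [g, g']) xs z"
  by (rule recf_eval.comp[where ys = "[y, y']"]) auto

lemma recf_eval_Proj: "i < length xs \<Longrightarrow> y = xs ! i \<Longrightarrow> recf_eval (Proj i) xs y"
  by (simp add: recf_eval.proj)

definition binary_recursive :: "(nat \<Rightarrow> nat \<Rightarrow> nat) \<Rightarrow> bool" where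
  "binary_recursive h \<longleftrightarrow> (\<exists>r. \<forall>x y. recf_eval r [x, y] (h x y))"

lemma total_recursive_comp2:
  assumes "binary_recursive h" "total_recursive f" "total_recursive g"
  shows "total_recursive (\<lambda>x. h (f x) (g x))"
proof -
  obtain rh rf rg where "recf_eval rh [x, y] (h x y)" "recf_eval rf [x] (f x)"
    "recf_eval rg [x] (g x)" for x y
    using assms unfolding binary_recursive_def total_recursive_def by metis
  then have "recf_eval (Comp rh [rf, rg]) [x] (h (f x) (g x))" for x
    by (intro recf_eval_Comp2)
  then show ?thesis unfolding total_recursive_def by blast
qed

lemma total_recursive_comp:
  assumes "total_recursive h" "total_recursive f"
  shows "total_recursive (\<lambda>x. h (f x))"
proof -
  obtain rh rf where "recf_eval rh [x] (h x)" "recf_eval rf [x] (f x)" for x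
    using assms unfolding total_recursive_def by metis
  then have "recf_eval (Comp rh [rf]) [x] (h (f x))" for x
    by (intro recf_eval_Comp1)
  then show ?thesis unfolding total_recursive_def by blast
qed

lemma binary_recursive_comp:
  assumes "total_recursive h" "binary_recursive f"
  shows "binary_recursive (\<lambda>x y. h (f x y))"
proof -
  obtain rh rf where "recf_eval rh [x] (h x)" "recf_eval rf [x, y] (f x y)" for x y
    using assms unfolding binary_recursive_def total_recursive_def by metis
  then have "recf_eval (Comp rh [rf]) [x, y] (h (f x y))" for x y
    by (intro recf_eval_Comp1)
  then show ?thesis unfolding binary_recursive_def by blast
qed

lemma binary_recursive_comp2:
  assumes "binary_recursive h" "binary_recursive f" "binary_recursive g"
  shows "binary_recursive (\<lambda>x y. h (f x y) (g x y))"
proof -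
  obtain rh rf rg where "recf_eval rh [x, y] (h x y)" "recf_eval rf [x, y] (f x y)"
    "recf_eval rg [x, y] (g x y)" for x y
    using assms unfolding binary_recursive_def by metis
  then have "recf_eval (Comp rh [rf, rg]) [x, y] (h (f x y) (g x y))" for x y
    by (intro recf_eval_Comp2)
  then show ?thesis unfolding binary_recursive_def by blast
qed

lemma binary_recursive_fst: "binary_recursive (\<lambda>x y. x)"
  unfolding binary_recursive_def by (rule exI[of _ "Proj 0"]) (simp add: recf_eval_Proj)

lemma binary_recursive_snd: "binary_recursive (\<lambda>x y. y)"
  unfolding binary_recursive_def by (rule exI[of _ "Proj 1"]) (simp add: recf_eval_Proj)

lemma total_recursive_id: "total_recursive (\<lambda>x. x)"
  unfolding total_recursive_def by (rule exI[of _ "Proj 0"]) (simp add: recf_eval_Proj)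

lemma total_recursive_Suc_fun: "total_recursive Suc"
  unfolding total_recursive_def by (blast intro: recf_eval.succ)

lemma total_recursive_const: "total_recursive (\<lambda>_. c)"
proof (induction c)
  case 0
  show ?case unfolding total_recursive_def by (blast intro: recf_eval.zero)
next
  case (Suc c)
  then show ?case by (rule total_recursive_comp[OF total_recursive_Suc_fun])
qed

lemma binary_recursive_add: "binary_recursive (+)"
proof -
  have "recf_eval (Prim (Proj 0) (Comp Succ [Proj 1])) [n, x] (n + x)" for n x
  proof (induction n)
    case 0
    show ?case by (rule recf_eval.prim_0) (simp add: recf_eval_Proj)
  next
    case (Suc n)
    have "recf_eval (Comp Succ [Proj 1]) [n, n + x, x] (Suc n + x)"
      using recf_eval.succ[of "n + x"] by (intro recf_eval_Comp1[where y = "n + x"] recf_eval_Proj) auto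
    then show ?case using Suc by (blast intro: recf_eval.prim_Suc)
  qed
  then show ?thesis unfolding binary_recursive_def by blast
qed

lemma total_recursive_pred: "total_recursive (\<lambda>n. n - 1)"
proof -
  have "recf_eval (Prim Zero (Proj 0)) [n] (n - 1)" for n
  proof (induction n)
    case 0
    show ?case using recf_eval.prim_0[OF recf_eval.zero] by simp
  next
    case (Suc n)
    have "recf_eval (Proj 0) [n, n - 1] (Suc n - 1)"
      by (rule recf_eval_Proj) auto
    then show ?case using Suc by (blast intro: recf_eval.prim_Suc)
  qed
  then show ?thesis unfolding total_recursive_def by blast
qed

text \<open>Primitive recursion runs on the first argument, so the subtrahend comes first: the
  predecessor is iterated \<open>n\<close> times on \<open>x\<close>.\<close>

lemma binary_recursive_diff: "binary_recursive (\<lambda>n x. x - n)"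
proof -
  obtain p where p: "recf_eval p [x] (x - 1)" for x
    using total_recursive_pred unfolding total_recursive_def by blast
  have "recf_eval (Prim (Proj 0) (Comp p [Proj 1])) [n, x] (x - n)" for n x
  proof (induction n)
    case 0
    show ?case by (rule recf_eval.prim_0) (simp add: recf_eval_Proj)
  next
    case (Suc n)
    have "recf_eval (Comp p [Proj 1]) [n, x - n, x] (x - Suc n)"
      using p[of "x - n"] by (intro recf_eval_Comp1[where y = "x - n"] recf_eval_Proj) auto
    then show ?case using Suc by (blast intro: recf_eval.prim_Suc)
  qed
  then show ?thesis unfolding binary_recursive_def by blast
qed

section \<open>Triangular numbers, Cantor pairing and its projections\<close>

lemma total_recursive_triangle: "total_recursive triangle"
proof -
  obtain p where p: "recf_eval p [x, y] (x + y)" for x y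
    using binary_recursive_add unfolding binary_recursive_def by blast
  have "recf_eval (Prim Zero (Comp p [Comp Succ [Proj 0], Proj 1])) [n] (triangle n)" for n
  proof (induction n)
    case 0
    show ?case using recf_eval.prim_0[OF recf_eval.zero] by simp
  next
    case (Suc n)
    have "recf_eval (Comp p [Comp Succ [Proj 0], Proj 1]) [n, triangle n] (triangle (Suc n))"
      using p[of "Suc n" "triangle n"]
      by (intro recf_eval_Comp2[where y = "Suc n" and y' = "triangle n"]
          recf_eval_Comp1[where y = n] recf_eval_Proj recf_eval.succ) (auto simp: add.commute)
    then show ?case using Suc by (blast intro: recf_eval.prim_Suc)
  qed
  then show ?thesis unfolding total_recursive_def by blast
qed

lemma binary_recursive_prod_encode: "binary_recursive (\<lambda>x y. prod_encode (x, y))"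
  unfolding prod_encode_def prod.case
  by (intro binary_recursive_comp2[OF binary_recursive_add] binary_recursive_fst
      binary_recursive_comp[OF total_recursive_triangle] binary_recursive_add)

lemma mono_triangle: "m \<le> n \<Longrightarrow> triangle m \<le> triangle n"
  by (induction rule: dec_induct) auto

abbreviation (input) pfst :: "nat \<Rightarrow> nat" where "pfst x \<equiv> fst (prod_decode x)"
abbreviation (input) psnd :: "nat \<Rightarrow> nat" where "psnd x \<equiv> snd (prod_decode x)"

lemma prod_encode_pfst_psnd: "triangle (pfst n + psnd n) + pfst n = n"
  using prod_decode_inverse[of n] by (simp add: prod_encode_def split_beta)

text \<open>The sum of the components of \<open>n\<close> is the least \<open>k\<close> with \<open>n < triangle (Suc k)\<close>.\<close>

lemma total_recursive_pfst_plus_psnd: "total_recursive (\<lambda>n. pfst n + psnd n)"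
proof -
  have "binary_recursive (\<lambda>k n. Suc n - triangle (Suc k))"
    by (intro binary_recursive_comp2[OF binary_recursive_diff]
        binary_recursive_comp[OF total_recursive_triangle]
        binary_recursive_comp[OF total_recursive_Suc_fun] binary_recursive_fst binary_recursive_snd)
  then obtain p where p: "recf_eval p [k, n] (Suc n - triangle (Suc k))" for k n
    unfolding binary_recursive_def by blast
  have "recf_eval (Mu p) [n] (pfst n + psnd n)" for n
  proof (rule recf_eval.mu)
    let ?k = "pfst n + psnd n"
    have "Suc n - triangle (Suc ?k) = 0"
      using prod_encode_pfst_psnd[of n] by simp
    then show "recf_eval p [?k, n] 0" using p[of ?k n] by simp
    show "\<forall>m<?k. \<exists>y>0. recf_eval p [m, n] y"
    proof (intro allI impI)
      fix m assume "m < ?k"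
      then have "triangle (Suc m) \<le> triangle ?k" by (intro mono_triangle) simp
      then have "Suc n - triangle (Suc m) > 0" using prod_encode_pfst_psnd[of n] by linarith
      then show "\<exists>y>0. recf_eval p [m, n] y" using p by blast
    qed
  qed
  then show ?thesis unfolding total_recursive_def by blast
qed

lemma total_recursive_pfst: "total_recursive pfst"
proof -
  have eq: "pfst n = n - triangle (pfst n + psnd n)" for n
    using prod_encode_pfst_psnd[of n] by linarith
  show ?thesis
    by (subst eq) (intro total_recursive_comp2[OF binary_recursive_diff] total_recursive_id
        total_recursive_comp[OF total_recursive_triangle] total_recursive_pfst_plus_psnd)
qed

lemma total_recursive_psnd: "total_recursive psnd"
  using total_recursive_comp2[OF binary_recursive_diff total_recursive_pfst
      total_recursive_pfst_plus_psnd] by simp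

text \<open>All closure rules speak of unary functions, so that \<open>intro\<close> can take an
  expression apart. The three arguments of the step are therefore packed into one number: counter
  \<open>pfst z\<close>, previous value \<open>pfst (psnd z)\<close>, parameter
  \<open>psnd (psnd z)\<close>.\<close>

lemma total_recursive_rec_nat:
  assumes "total_recursive a" "total_recursive b"
    and "total_recursive (\<lambda>z. G (psnd (psnd z)) (pfst z) (pfst (psnd z)))"
  shows "total_recursive (\<lambda>x. rec_nat (a x) (\<lambda>m r. G x m r) (b x))"
proof -
  obtain ra rg rp where ra: "recf_eval ra [x] (a x)"
    and rg: "recf_eval rg [z] (G (psnd (psnd z)) (pfst z) (pfst (psnd z)))"
    and rp: "recf_eval rp [x, y] (prod_encode (x, y))" for x y z
    using assms(1,3) binary_recursive_prod_encode
    unfolding total_recursive_def binary_recursive_def by blast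
  define rs where "rs = Comp rg [Comp rp [Proj 0, Comp rp [Proj 1, Proj 2]]]"
  have rs: "recf_eval rs [m, r, x] (G x m r)" for m r x
    unfolding rs_def
    by (rule recf_eval_Comp1[OF recf_eval_Comp2[OF _ recf_eval_Comp2[OF _ _ rp] rp]])
      (use rg[of "prod_encode (m, prod_encode (r, x))"] in \<open>auto intro: recf_eval_Proj\<close>)
  have "recf_eval (Prim ra rs) [n, x] (rec_nat (a x) (G x) n)" for n x
  proof (induction n)
    case 0
    then show ?case using recf_eval.prim_0[OF ra] by simp
  next
    case (Suc n)
    then show ?case using recf_eval.prim_Suc[OF Suc rs] by simp
  qed
  then have "binary_recursive (\<lambda>n x. rec_nat (a x) (G x) n)"
    unfolding binary_recursive_def by blast
  from total_recursive_comp2[OF this assms(2) total_recursive_id] show ?thesis by simp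
qed

lemmas total_recursive_basic_intros =
  total_recursive_id total_recursive_const
  total_recursive_comp[OF total_recursive_Suc_fun]
  total_recursive_comp2[OF binary_recursive_add]
  total_recursive_comp2[OF binary_recursive_diff]
  total_recursive_comp2[OF binary_recursive_prod_encode]
  total_recursive_comp[OF total_recursive_pfst]
  total_recursive_comp[OF total_recursive_psnd]

text \<open>A case distinction is a recursion on the tested number that ignores its previous
  value.\<close>

lemma total_recursive_If:
  assumes "total_recursive a" "total_recursive b" "total_recursive c"
  shows "total_recursive (\<lambda>x. if a x = 0 then b x else c x)"
proof -
  have "(if n = 0 then p else q) = rec_nat p (\<lambda>_ _. q) n" for n p q :: nat
    by (cases n) auto
  then show ?thesis
    using assms by (simp only:) (intro total_recursive_rec_nat total_recursive_comp[OF assms(3)]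
      total_recursive_basic_intros)
qed

lemma total_recursive_mult:
  assumes "total_recursive a" "total_recursive b"
  shows "total_recursive (\<lambda>x. a x * b x)"
proof -
  have "n * m = rec_nat 0 (\<lambda>_ r. m + r) n" for m n :: nat
    by (induction n) auto
  then show ?thesis
    using assms by (simp only:) (intro total_recursive_rec_nat total_recursive_comp[OF assms(2)]
      total_recursive_basic_intros)
qed

lemma total_recursive_power2:
  assumes "total_recursive a"
  shows "total_recursive (\<lambda>x. 2 ^ a x)"
proof -
  have "(2::nat) ^ n = rec_nat 1 (\<lambda>_ r. r + r) n" for n
    by (induction n) (simp_all only: power_0 power_Suc old.nat.rec mult_2)
  then show ?thesis
    using assms by (simp only:) (intro total_recursive_rec_nat total_recursive_basic_intros)
qed

lemma total_recursive_fact: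
  assumes "total_recursive a"
  shows "total_recursive (\<lambda>x. fact (a x))"
proof -
  have "(fact n :: nat) = rec_nat 1 (\<lambda>m r. Suc m * r) n" for n
    by (induction n) (simp_all only: fact_0 fact_Suc old.nat.rec of_nat_id)
  then show ?thesis
    using assms
    by (simp only:) (intro total_recursive_rec_nat total_recursive_mult total_recursive_basic_intros)
qed

section \<open>Recursive functions on coded lists\<close>

abbreviation list_recursive :: "(nat \<Rightarrow> nat list) \<Rightarrow> bool" where
  "list_recursive F \<equiv> total_recursive (\<lambda>x. list_encode (F x))"

lemma length_le_list_encode: "length xs \<le> list_encode xs"
proof (induction xs)
  case (Cons x xs)
  have "list_encode xs \<le> prod_encode (x, list_encode xs)" by (rule le_prod_encode_2)
  with Cons show ?case by simp
qed simp

text \<open>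
  The recursion acts on a pair of the remaining list and the accumulator. The code of the
  list bounds its length, so it is a sufficient number of steps.
\<close>

lemma total_recursive_foldl:
  assumes a: "total_recursive a" and L: "list_recursive L"
    and G: "total_recursive (\<lambda>z. G (psnd (psnd z)) (pfst z) (pfst (psnd z)))"
  shows "total_recursive (\<lambda>x. foldl (\<lambda>r y. G x r y) (a x) (L x))"
proof -
  \<comment> \<open>The empty list has code 0 and a nonempty one the successor of a pair code, hence
    the test for 0 and the \<open>- 1\<close>. On the empty list the state is fixed, so surplus
    steps do no harm.\<close>
  define st where "st x r = (if pfst r = 0 then r
    else prod_encode (psnd (pfst r - 1), G x (psnd r) (pfst (pfst r - 1))))" for x r
  have run: "psnd (rec_nat (prod_encode (list_encode xs, c)) (\<lambda>_. st x) n) = foldl (G x) c xs"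
    if "length xs \<le> n" for xs c x n
  proof -
    have "rec_nat (prod_encode (list_encode (xs), c)) (\<lambda>_. st x) m =
        prod_encode (list_encode (drop m xs), foldl (G x) c (take m xs))" for m
    proof (induction m)
      case (Suc m)
      show ?case
      proof (cases "m < length xs")
        case True
        then have "drop m xs = xs ! m # drop (Suc m) xs" "take (Suc m) xs = take m xs @ [xs ! m]"
          by (auto simp: Cons_nth_drop_Suc take_Suc_conv_app_nth)
        then show ?thesis using Suc by (simp add: st_def)
      qed (use Suc in \<open>simp add: st_def\<close>)
    qed simp
    with that show ?thesis by simp
  qed
  have st: "total_recursive (\<lambda>z. st (f z) (g z))" if "total_recursive f" "total_recursive g" for f g
  proof -
    have "total_recursive (\<lambda>z. G (psnd (psnd (h z))) (pfst (h z)) (pfst (psnd (h z))))"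
      if "total_recursive h" for h
      using total_recursive_comp[OF G that] .
    from this[of "\<lambda>z. prod_encode (psnd (g z), prod_encode (pfst (pfst (g z) - 1), f z))"] that
    have "total_recursive (\<lambda>z. G (f z) (psnd (g z)) (pfst (pfst (g z) - 1)))"
      by (simp add: total_recursive_basic_intros)
    then show ?thesis
      unfolding st_def using that
      by (intro total_recursive_If total_recursive_basic_intros)
  qed
  have "total_recursive (\<lambda>x. psnd (rec_nat (prod_encode (list_encode (L x), a x)) (\<lambda>_. st x)
      (list_encode (L x))))"
    by (intro total_recursive_rec_nat total_recursive_basic_intros st a L)
  then show ?thesis
    by (simp add: run length_le_list_encode)
qed

text \<open>An accumulator that is itself a list is carried along as its code; the step decodes it,
  which is why \<open>G\<close> is tested at \<open>list_decode (pfst z)\<close>.\<close>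

lemma list_recursive_foldl:
  assumes "list_recursive a" "list_recursive L"
    and "list_recursive (\<lambda>z. G (psnd (psnd z)) (list_decode (pfst z)) (pfst (psnd z)))"
  shows "list_recursive (\<lambda>x. foldl (\<lambda>r y. G x r y) (a x) (L x))"
proof -
  have "list_encode (foldl (\<lambda>r y. G x r y) b l) =
      foldl (\<lambda>r y. list_encode (G x (list_decode r) y)) (list_encode b) l" for x b l
    by (induction l arbitrary: b) auto
  then show ?thesis
    using assms by (simp only:) (rule total_recursive_foldl)
qed

lemma list_recursive_Nil: "list_recursive (\<lambda>_. [])"
  by (rule total_recursive_const)

lemma list_recursive_Cons:
  assumes "total_recursive f" "list_recursive L"
  shows "list_recursive (\<lambda>x. f x # L x)"
  using assms by (simp del: One_nat_def) (intro total_recursive_basic_intros)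

lemma list_recursive_decode:
  assumes "total_recursive f"
  shows "list_recursive (\<lambda>x. list_decode (f x))"
  using assms by simp

lemma list_recursive_rev:
  assumes "list_recursive L"
  shows "list_recursive (\<lambda>x. rev (L x))"
proof -
  have "rev xs = foldl (\<lambda>r y. y # r) [] xs" for xs :: "nat list"
    by (simp add: foldl_conv_fold fold_Cons_rev)
  then show ?thesis
    by (simp only:) (intro list_recursive_foldl list_recursive_Cons list_recursive_Nil
        list_recursive_decode total_recursive_basic_intros assms)
qed

lemma list_recursive_append:
  assumes "list_recursive K" "list_recursive L"
  shows "list_recursive (\<lambda>x. K x @ L x)"
proof -
  have "xs @ ys = foldl (\<lambda>r y. y # r) ys (rev xs)" for xs ys :: "nat list"
    by (simp add: foldl_conv_fold fold_Cons_rev)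
  then show ?thesis
    by (simp only:) (intro list_recursive_foldl list_recursive_Cons list_recursive_rev
        list_recursive_decode total_recursive_basic_intros assms)
qed

lemma list_recursive_concat_map:
  assumes "list_recursive L" "list_recursive (\<lambda>z. G (pfst z) (psnd z))"
  shows "list_recursive (\<lambda>x. concat (map (\<lambda>y. G x y) (L x)))"
proof -
  have "foldl (\<lambda>r y. r @ g y) b xs = b @ concat (map g xs)" for g and b xs :: "nat list"
    by (induction xs arbitrary: b) auto
  from this[of _ "[]"] have eq: "concat (map g xs) = foldl (\<lambda>r y. r @ g y) [] xs"
    for g :: "nat \<Rightarrow> nat list" and xs by simp
  have G: "list_recursive (\<lambda>z. G (f z) (g z))" if "total_recursive f" "total_recursive g" for f g
    using total_recursive_comp[OF assms(2), of "\<lambda>z. prod_encode (f z, g z)"] that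
    by (simp add: total_recursive_basic_intros)
  show ?thesis
    unfolding eq
    by (intro G list_recursive_foldl list_recursive_append list_recursive_Nil
        list_recursive_decode total_recursive_basic_intros assms(1))
qed

lemma list_recursive_map:
  assumes "list_recursive L" "total_recursive (\<lambda>z. G (pfst z) (psnd z))"
  shows "list_recursive (\<lambda>x. map (\<lambda>y. G x y) (L x))"
proof -
  have "map g xs = concat (map (\<lambda>y. [g y]) xs)" for g :: "nat \<Rightarrow> nat" and xs
    by (induction xs) auto
  then show ?thesis
    by (simp only:) (intro list_recursive_concat_map list_recursive_Cons list_recursive_Nil assms)
qed

lemma list_recursive_upt:
  assumes "total_recursive f"
  shows "list_recursive (\<lambda>x. [0..<f x])"
proof -
  have "rec_nat (list_encode []) (\<lambda>m r. list_encode (list_decode r @ [m])) n = list_encode [0..<n]" for n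
    by (induction n) (auto simp del: list_encode.simps)
  note eq = this[symmetric]
  then show ?thesis
    unfolding eq
    by (intro total_recursive_rec_nat list_recursive_append list_recursive_Cons
        list_recursive_Nil list_recursive_decode total_recursive_basic_intros assms)
qed

lemmas total_recursive_intros =
  total_recursive_basic_intros total_recursive_If total_recursive_mult total_recursive_power2
  total_recursive_fact list_recursive_decode list_recursive_concat_map list_recursive_map
  list_recursive_upt

text \<open>As safe rules these let classical search enumerate words and diverge.\<close>

declare lists.intros [rule del] in_listsI [rule del] in_listsD [rule del]

section \<open>Enrichment through numbered tags\<close>

text \<open>Tagging where the partition is given by the fibres of \<open>f\<close> and the block by
  its number. Tagged letters are again numbers, so a tagged word can be tagged once more.\<close>

definition tag_by :: "(nat list \<Rightarrow> nat) \<Rightarrow> nat list \<Rightarrow> nat list" where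
  "tag_by f w = map (\<lambda>i. prod_encode (f (take i w), w ! i)) [0..<length w]"

definition tag_alphabet :: "(nat list \<Rightarrow> nat) \<Rightarrow> nat set \<Rightarrow> nat set" where
  "tag_alphabet f A = prod_encode ` (f ` lists A \<times> A)"

text \<open>Closure under inverse images of letter-to-letter morphisms: the part of being a positive
  variety that is shown to survive enrichment by \<open>SU\<close>, and all that the outer
  enrichment by \<open>MOD\<close> asks of its base class.\<close>

definition letter_closed :: "lang_class \<Rightarrow> bool" where
  "letter_closed C \<longleftrightarrow> (\<forall>A B h. finite A \<longrightarrow> finite B \<longrightarrow> h ` A \<subseteq> B \<longrightarrow>
     (\<forall>L\<in>C B. {w \<in> lists A. map h w \<in> L} \<in> C A))"

text \<open>Liftability for numbered tags; \<open>F x\<close> is the language used on the block with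
  number \<open>x\<close>.\<close>

definition representable ::
    "lang_class \<Rightarrow> nat set \<Rightarrow> (nat list \<Rightarrow> nat) \<Rightarrow> nat list set \<Rightarrow> bool" where
  "representable C A f L \<longleftrightarrow> (\<exists>F. (\<forall>x\<in>f ` lists A. F x \<in> C (tag_alphabet f A)) \<and>
     L = {w \<in> lists A. tag_by f w \<in> F (f w)})"

lemma tag_by_Nil [simp]: "tag_by f [] = []"
  by (simp add: tag_by_def)

lemma length_tag_by [simp]: "length (tag_by f w) = length w"
  by (simp add: tag_by_def)

lemma tag_by_append: "tag_by f (u @ v) = tag_by f u @ tag_by (\<lambda>x. f (u @ x)) v"
proof (rule nth_equalityI)
  fix i assume "i < length (tag_by f (u @ v))"
  then show "tag_by f (u @ v) ! i = (tag_by f u @ tag_by (\<lambda>x. f (u @ x)) v) ! i"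
    by (auto simp: tag_by_def nth_append)
qed simp

lemma tag_by_singleton [simp]: "tag_by f [a] = [prod_encode (f [], a)]"
  by (simp add: tag_by_def)

lemma tag_by_snoc [simp]: "tag_by f (w @ [a]) = tag_by f w @ [prod_encode (f w, a)]"
  by (simp add: tag_by_append)

lemma take_in_lists: "w \<in> lists A \<Longrightarrow> take i w \<in> lists A"
  by (auto simp: in_lists_conv_set dest: in_set_takeD)

lemma drop_in_lists: "w \<in> lists A \<Longrightarrow> drop i w \<in> lists A"
  by (auto simp: in_lists_conv_set dest: in_set_dropD)

lemma tag_by_in_lists: "w \<in> lists A \<Longrightarrow> tag_by f w \<in> lists (tag_alphabet f A)"
  unfolding tag_by_def tag_alphabet_def by (auto intro!: imageI simp: in_lists_conv_set dest!: in_set_takeD)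

lemma finite_tag_alphabet: "finite A \<Longrightarrow> finite (f ` lists A) \<Longrightarrow> finite (tag_alphabet f A)"
  by (simp add: tag_alphabet_def)

lemma letter_closedD:
  assumes "letter_closed C" "finite A" "finite B" "h ` A \<subseteq> B" "L \<in> C B"
  shows "{w \<in> lists A. map h w \<in> L} \<in> C A"
  using assms unfolding letter_closed_def by blast

text \<open>A tag of the finer \<open>g\<close> determines the tag of \<open>f\<close>, so a
  renaming of letters turns one tagged word into the other and the languages \<open>F x\<close> can
  be pulled back along it. This brings several languages to a common modulus or suffix
  length.\<close>

lemma representable_refine:
  assumes C: "letter_closed C" and A: "finite A" and g: "finite (g ` lists A)"
    and L: "representable C A f L"
    and fg: "\<And>w w'. w \<in> lists A \<Longrightarrow> w' \<in> lists A \<Longrightarrow> g w = g w' \<Longrightarrow> f w = f w'"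
  shows "representable C A g L"
proof -
  obtain F where F: "\<And>x. x \<in> f ` lists A \<Longrightarrow> F x \<in> C (tag_alphabet f A)"
    and L: "L = {w \<in> lists A. tag_by f w \<in> F (f w)}"
    using L unfolding representable_def by blast
  define h where "h x = f (SOME w. w \<in> lists A \<and> g w = x)" for x
  have h: "h (g w) = f w" if "w \<in> lists A" for w
  proof -
    let ?v = "SOME v. v \<in> lists A \<and> g v = g w"
    have "?v \<in> lists A \<and> g ?v = g w"
      by (rule someI[of _ w]) (use that in simp)
    then show ?thesis unfolding h_def using fg[of ?v w] that by simp
  qed
  define \<phi> where "\<phi> n = (case prod_decode n of (x, a) \<Rightarrow> prod_encode (h x, a))" for n
  have "f ` lists A = h ` g ` lists A"
    unfolding image_image using h by (intro image_cong) auto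
  then have f: "finite (f ` lists A)"
    using g by simp
  have \<phi>: "\<phi> ` tag_alphabet g A \<subseteq> tag_alphabet f A"
  proof
    fix n assume "n \<in> \<phi> ` tag_alphabet g A"
    then obtain w a where "w \<in> lists A" "a \<in> A" "n = \<phi> (prod_encode (g w, a))"
      unfolding tag_alphabet_def by blast
    then show "n \<in> tag_alphabet f A"
      unfolding tag_alphabet_def by (simp add: \<phi>_def h)
  qed
  have tag: "map \<phi> (tag_by g w) = tag_by f w" if "w \<in> lists A" for w
    unfolding tag_by_def using take_in_lists[OF that] by (simp add: \<phi>_def h)
  define F' where "F' x = {u \<in> lists (tag_alphabet g A). map \<phi> u \<in> F (h x)}" for x
  have "F' x \<in> C (tag_alphabet g A)" if "x \<in> g ` lists A" for x
  proof -
    have "h x \<in> f ` lists A" using that by (rule imageE) (simp add: h)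
    from letter_closedD[OF C finite_tag_alphabet[OF A g] finite_tag_alphabet[OF A f] \<phi> F[OF this]]
    show ?thesis unfolding F'_def .
  qed
  moreover have "L = {w \<in> lists A. tag_by g w \<in> F' (g w)}"
  proof -
    have "tag_by g w \<in> F' (g w) \<longleftrightarrow> tag_by f w \<in> F (f w)" if "w \<in> lists A" for w
      unfolding F'_def using tag_by_in_lists[OF that, of g] by (simp only: mem_Collect_eq tag[OF that] h[OF that]) simp
    then show ?thesis unfolding L by blast
  qed
  ultimately show ?thesis unfolding representable_def by blast
qed

section \<open>Partitions versus tag functions\<close>

lemma block_in_partition:
  assumes "partition_on X P" "w \<in> X"
  shows "block P w \<in> P" "w \<in> block P w"
proof -
  obtain B where B: "B \<in> P" "w \<in> B"
    using assms by (auto simp: partition_on_def)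
  have "block P w = B"
    unfolding block_def using B assms(1)
    by (intro the_equality) (auto simp: partition_on_def disjoint_def)
  then show "block P w \<in> P" "w \<in> block P w" using B by auto
qed

lemma block_eqI:
  assumes "partition_on X P" "B \<in> P" "w \<in> B"
  shows "block P w = B"
  unfolding block_def using assms
  by (intro the_equality) (auto simp: partition_on_def disjoint_def)

lemma tagging_in_lists:
  assumes "partition_on (lists A) P" "w \<in> lists A"
  shows "tagging P w \<in> lists (P \<times> A)"
  using block_in_partition(1)[OF assms(1)] take_in_lists[OF assms(2)] assms(2)
  by (auto simp: tagging_def in_lists_conv_set)

text \<open>Number the blocks by an injection \<open>\<nu>\<close>. Each language \<open>F B\<close>
  comes with its own numbering \<open>e B\<close> of the tagged alphabet; letter closure translates
  all of them to the single alphabet of pair codes.\<close>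

lemma enrich_imp_representable:
  assumes C: "letter_closed C" and A: "finite A" and L: "L \<in> (C \<circ>\<^sub>e D) A"
  obtains f where "finite (f ` lists A)" "representable C A f L"
    "\<And>x. x \<in> f ` lists A \<Longrightarrow> {w \<in> lists A. f w = x} \<in> D A"
proof -
  obtain P F where P: "finite P" "partition_on (lists A) P" "P \<subseteq> D A"
    and F: "\<And>B. B \<in> P \<Longrightarrow> F B \<in> at_alphabet C (P \<times> A)"
    and L: "L = (\<Union>B\<in>P. {w \<in> lists A. tagging P w \<in> F B} \<inter> B)"
    using L unfolding enrich_def liftable_def by blast
  have "\<exists>e. inj_on e (P \<times> A) \<and> map e ` F B \<in> C (e ` (P \<times> A))" "F B \<subseteq> lists (P \<times> A)"
    if "B \<in> P" for B
    using F[OF that] unfolding at_alphabet_def by auto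
  then obtain e where e: "\<And>B. B \<in> P \<Longrightarrow> inj_on (e B) (P \<times> A)"
    "\<And>B. B \<in> P \<Longrightarrow> map (e B) ` F B \<in> C (e B ` (P \<times> A))"
    "\<And>B. B \<in> P \<Longrightarrow> F B \<subseteq> lists (P \<times> A)"
    by metis
  obtain \<nu> :: "nat list set \<Rightarrow> nat" where \<nu>: "inj_on \<nu> P"
    using finite_imp_inj_to_nat_seg[OF P(1)] by blast
  define f where "f w = \<nu> (block P w)" for w
  note blk = block_in_partition[OF P(2)]
  have inv: "inv_into P \<nu> (f w) = block P w" if "w \<in> lists A" for w
    using \<nu> blk(1)[OF that] by (simp add: f_def)
  have "f ` lists A \<subseteq> \<nu> ` P"
    using blk(1) by (auto simp: f_def)
  then have fin: "finite (f ` lists A)"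
    using P(1) finite_subset by blast
  define \<psi> where "\<psi> B n = e B (inv_into P \<nu> (fst (prod_decode n)), snd (prod_decode n))" for B n
  have \<psi>: "\<psi> B ` tag_alphabet f A \<subseteq> e B ` (P \<times> A)" for B
  proof
    fix n assume "n \<in> \<psi> B ` tag_alphabet f A"
    then obtain w a where "w \<in> lists A" "a \<in> A" "n = \<psi> B (prod_encode (f w, a))"
      unfolding tag_alphabet_def by blast
    then show "n \<in> e B ` (P \<times> A)"
      using blk(1) by (simp add: \<psi>_def inv)
  qed
  have tag: "map (\<psi> B) (tag_by f w) = map (e B) (tagging P w)" if "w \<in> lists A" for B w
    unfolding tag_by_def tagging_def using take_in_lists[OF that] by (simp add: \<psi>_def inv)
  define F' where "F' x = {u \<in> lists (tag_alphabet f A).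
      map (\<psi> (inv_into P \<nu> x)) u \<in> map (e (inv_into P \<nu> x)) ` F (inv_into P \<nu> x)}" for x
  have F': "F' x \<in> C (tag_alphabet f A)" if "x \<in> f ` lists A" for x
  proof -
    have "inv_into P \<nu> x \<in> P" using that inv blk(1) by auto
    then show ?thesis
      unfolding F'_def using P(1) A
      by (intro letter_closedD[OF C finite_tag_alphabet[OF A fin] _ \<psi> e(2)]) auto
  qed
  have "w \<in> L \<longleftrightarrow> tag_by f w \<in> F' (f w)" if w: "w \<in> lists A" for w
  proof -
    let ?B = "block P w"
    have "w \<in> L \<longleftrightarrow> (\<exists>B\<in>P. w \<in> B \<and> tagging P w \<in> F B)"
      unfolding L using w by blast
    also have "\<dots> \<longleftrightarrow> tagging P w \<in> F ?B"
      using blk[OF w] block_eqI[OF P(2)] by metis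
    also have "\<dots> \<longleftrightarrow> map (e ?B) (tagging P w) \<in> map (e ?B) ` F ?B"
    proof -
      have "inj_on (map (e ?B)) (lists (P \<times> A))"
        by (rule inj_on_mapI, rule inj_on_subset[OF e(1)[OF blk(1)[OF w]]])
          (auto simp: in_lists_conv_set)
      then show ?thesis
        using inj_on_image_mem_iff[of "map (e ?B)" "lists (P \<times> A)" "tagging P w"]
          tagging_in_lists[OF P(2) w] e(3)[OF blk(1)[OF w]] by blast
    qed
    also have "\<dots> \<longleftrightarrow> tag_by f w \<in> F' (f w)"
      unfolding F'_def inv[OF w] using tag[OF w] tag_by_in_lists[OF w] by simp
    finally show ?thesis .
  qed
  moreover have "L \<subseteq> lists A"
    unfolding L by blast
  ultimately have "L = {w \<in> lists A. tag_by f w \<in> F' (f w)}"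
    by blast
  then have "representable C A f L" unfolding representable_def using F' by blast
  moreover have "{w \<in> lists A. f w = x} \<in> D A" if x: "x \<in> f ` lists A" for x
  proof -
    obtain v where v: "v \<in> lists A" "x = f v" using x by blast
    have "{w \<in> lists A. f w = x} = block P v"
    proof
      show "{w \<in> lists A. f w = x} \<subseteq> block P v"
      proof
        fix w assume "w \<in> {w \<in> lists A. f w = x}"
        then have w: "w \<in> lists A" "\<nu> (block P w) = \<nu> (block P v)"
          using v by (auto simp: f_def)
        then have "block P w = block P v"
          using inj_onD[OF \<nu>] blk(1) v(1) by blast
        then show "w \<in> block P v" using blk(2)[OF w(1)] by simp
      qed
      show "block P v \<subseteq> {w \<in> lists A. f w = x}"
      proof
        fix w assume w: "w \<in> block P v"
        then have "w \<in> lists A" using blk(1)[OF v(1)] P(2) by (auto simp: partition_on_def)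
        moreover have "block P w = block P v" using block_eqI[OF P(2) blk(1)[OF v(1)] w] .
        ultimately show "w \<in> {w \<in> lists A. f w = x}" using v by (simp add: f_def)
      qed
    qed
    then show ?thesis using blk(1)[OF v(1)] P(3) by auto
  qed
  ultimately show thesis using that fin by blast
qed

text \<open>The fibres of \<open>f\<close> serve as blocks, and the value of \<open>f\<close> on a
  block serves as its number.\<close>

lemma representable_imp_enrich:
  assumes C: "letter_closed C" and A: "finite A" and L: "representable C A f L"
    and f: "finite (f ` lists A)"
    and D: "\<And>x. x \<in> f ` lists A \<Longrightarrow> {w \<in> lists A. f w = x} \<in> D A"
  shows "L \<in> (C \<circ>\<^sub>e D) A"
proof -
  obtain F where F: "\<And>x. x \<in> f ` lists A \<Longrightarrow> F x \<in> C (tag_alphabet f A)"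
    and L: "L = {w \<in> lists A. tag_by f w \<in> F (f w)}"
    using L unfolding representable_def by blast
  define fib where "fib x = {w \<in> lists A. f w = x}" for x
  define P where "P = fib ` f ` lists A"
  have part: "partition_on (lists A) P"
    by (rule partition_onI) (auto simp: P_def fib_def disjnt_def)
  have blk: "block P w = fib (f w)" if "w \<in> lists A" for w
    by (rule block_eqI[OF part]) (use that in \<open>auto simp: P_def fib_def\<close>)
  define num where "num B = f (SOME w. w \<in> B)" for B
  have num: "num (fib (f w)) = f w" if "w \<in> lists A" for w
  proof -
    have "(SOME v. v \<in> fib (f w)) \<in> fib (f w)"
      by (rule someI[of _ w]) (use that in \<open>simp add: fib_def\<close>)
    then show ?thesis unfolding num_def by (auto simp: fib_def)
  qed
  define e where "e = (\<lambda>(B, a). prod_encode (num B, a))"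
  have e_img: "e ` (P \<times> A) = tag_alphabet f A"
    unfolding tag_alphabet_def P_def using num by (force simp: e_def image_iff)
  have "inj_on num P"
    by (auto simp: P_def num intro!: inj_onI)
  then have e_inj: "inj_on e (P \<times> A)"
    by (auto simp: e_def prod_encode_eq dest: inj_onD intro!: inj_onI)
  have tag: "map e (tagging P w) = tag_by f w" if "w \<in> lists A" for w
    unfolding tag_by_def tagging_def using take_in_lists[OF that] by (simp add: e_def blk num)
  define F' where "F' B = {t \<in> lists (P \<times> A). map e t \<in> F (num B)}" for B
  have "F' B \<in> at_alphabet C (P \<times> A)" if B: "B \<in> P" for B
  proof -
    \<comment> \<open>The map \<open>id\<close> is there to apply letter closure: it cuts
      \<open>F (num B)\<close> down to words over the tagged alphabet, to which letter closure alone
      does not confine it.\<close>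
    have "map e ` F' B = {u \<in> lists (tag_alphabet f A). map id u \<in> F (num B)}"
    proof -
      have "map e ` lists (P \<times> A) = lists (tag_alphabet f A)"
        by (simp only: e_img[symmetric] lists_image)
      then show ?thesis unfolding F'_def by auto
    qed
    also have "\<dots> \<in> C (tag_alphabet f A)"
    proof -
      have "num B \<in> f ` lists A" using B unfolding P_def by (auto simp: num)
      note fin = finite_tag_alphabet[OF A f]
      show ?thesis
        by (rule letter_closedD[OF C fin fin _ F]) (use \<open>num B \<in> f ` lists A\<close> in simp_all)
    qed
    finally show ?thesis
      unfolding at_alphabet_def using e_inj e_img by (auto simp: F'_def)
  qed
  moreover have "L = (\<Union>B\<in>P. {w \<in> lists A. tagging P w \<in> F' B} \<inter> B)"
  proof (rule set_eqI)
    fix w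
    show "w \<in> L \<longleftrightarrow> w \<in> (\<Union>B\<in>P. {w \<in> lists A. tagging P w \<in> F' B} \<inter> B)"
    proof (cases "w \<in> lists A")
      case True
      have "w \<in> (\<Union>B\<in>P. {w \<in> lists A. tagging P w \<in> F' B} \<inter> B) \<longleftrightarrow>
          (\<exists>B\<in>P. w \<in> B \<and> tagging P w \<in> F' B)"
        using True by blast
      also have "\<dots> \<longleftrightarrow> tagging P w \<in> F' (block P w)"
        using block_in_partition[OF part True] block_eqI[OF part] by metis
      also have "\<dots> \<longleftrightarrow> w \<in> L"
        unfolding L F'_def using True tagging_in_lists[OF part True] by (simp add: tag blk num)
      finally show ?thesis by simp
    qed (auto simp: L)
  qed
  ultimately have "liftable C A P L" unfolding liftable_def by blast
  moreover have "finite P" "P \<subseteq> D A"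
    using f D by (auto simp: P_def fib_def)
  ultimately show ?thesis unfolding enrich_def using part by blast
qed

section \<open>Modulo languages and suffix languages\<close>

lemma boolean_combinations_subset:
  assumes "L \<in> boolean_combinations A G" "\<And>K. K \<in> G \<Longrightarrow> K \<subseteq> lists A"
  shows "L \<subseteq> lists A"
  using assms by (induction rule: boolean_combinations.induct) auto

text \<open>The language is, within \<open>lists A\<close>, a union of fibres of \<open>f\<close>.
  This passes through Boolean operations and to finer functions, so one modulus or one suffix length
  serves a whole Boolean combination.\<close>

definition invariant_under :: "nat set \<Rightarrow> (nat list \<Rightarrow> 'b) \<Rightarrow> nat list set \<Rightarrow> bool" where
  "invariant_under A f L \<longleftrightarrow>
     (\<forall>w\<in>lists A. \<forall>w'\<in>lists A. f w = f w' \<longrightarrow> (w \<in> L \<longleftrightarrow> w' \<in> L))"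

lemma invariant_under_Un:
  "invariant_under A f K \<Longrightarrow> invariant_under A f L \<Longrightarrow> invariant_under A f (K \<union> L)"
  unfolding invariant_under_def Un_iff by metis

lemma invariant_under_Int:
  "invariant_under A f K \<Longrightarrow> invariant_under A f L \<Longrightarrow> invariant_under A f (K \<inter> L)"
  unfolding invariant_under_def Int_iff by metis

lemma invariant_under_compl: "invariant_under A f L \<Longrightarrow> invariant_under A f (lists A - L)"
  unfolding invariant_under_def Diff_iff by metis

lemma invariant_under_fibreD:
  assumes "invariant_under A g {w \<in> lists A. f w = f u}" "u \<in> lists A" "v \<in> lists A" "g u = g v"
  shows "f u = f v"
  using assms(1)[unfolded invariant_under_def, rule_format, OF assms(2-4)] assms(2,3) by simp

lemma invariant_under_mod_mult:
  "invariant_under A (\<lambda>w. length w mod d) L \<Longrightarrow> d dvd e \<Longrightarrow> invariant_under A (\<lambda>w. length w mod e) L"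
  unfolding invariant_under_def by (metis mod_mod_cancel)

lemma MOD_invariant:
  assumes "L \<in> MOD A"
  obtains d where "d > 0" "\<And>e. d dvd e \<Longrightarrow> invariant_under A (\<lambda>w. length w mod e) L"
proof -
  have "\<exists>d>0. invariant_under A (\<lambda>w. length w mod d) L"
    using assms unfolding MOD_def
  proof (induction rule: boolean_combinations.induct)
    case (gen L)
    then obtain m d where "L = {w \<in> lists A. length w mod d = m}" "m < d" by blast
    then show ?case
      by (intro exI[of _ d]) (auto simp: invariant_under_def)
  next
    case (un K L)
    then obtain d e where "d > 0" "e > 0"
      "invariant_under A (\<lambda>w. length w mod d) K" "invariant_under A (\<lambda>w. length w mod e) L" by blast
    then have "d * e > 0" "invariant_under A (\<lambda>w. length w mod (d * e)) K"
      "invariant_under A (\<lambda>w. length w mod (d * e)) L"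
      by (auto elim: invariant_under_mod_mult)
    then show ?case
      using invariant_under_Un by blast
  next
    case (int K L)
    then obtain d e where "d > 0" "e > 0"
      "invariant_under A (\<lambda>w. length w mod d) K" "invariant_under A (\<lambda>w. length w mod e) L" by blast
    then have "d * e > 0" "invariant_under A (\<lambda>w. length w mod (d * e)) K"
      "invariant_under A (\<lambda>w. length w mod (d * e)) L"
      by (auto elim: invariant_under_mod_mult)
    then show ?case
      using invariant_under_Int by blast
  next
    case (compl L)
    then show ?case using invariant_under_compl by blast
  qed
  then show thesis using that invariant_under_mod_mult by blast
qed

section \<open>Suffixes of bounded length\<close>

definition sfx :: "nat \<Rightarrow> 'a list \<Rightarrow> 'a list" where
  "sfx k w = drop (length w - k) w"

lemma length_sfx [simp]: "length (sfx k w) = min k (length w)"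
  by (auto simp: sfx_def)

lemma sfx_full [simp]: "length w \<le> k \<Longrightarrow> sfx k w = w"
  by (simp add: sfx_def)

lemma sfx_append: "k \<le> length v \<Longrightarrow> sfx k (u @ v) = sfx k v"
  by (simp add: sfx_def)

lemma sfx_sfx: "k \<le> l \<Longrightarrow> sfx k (sfx l w) = sfx k w"
  by (cases "l \<le> length w") (simp_all add: sfx_def)

lemma sfx_append_cong: "sfx k u = sfx k u' \<Longrightarrow> sfx k (u @ v) = sfx k (u' @ v)"
proof -
  have "sfx k (u @ v) = sfx k (sfx k u @ v)" for u
    by (cases "k \<le> length u") (simp_all add: sfx_def add.commute)
  then show "sfx k u = sfx k u' \<Longrightarrow> sfx k (u @ v) = sfx k (u' @ v)" by metis
qed

lemma sfx_map: "sfx k (map f w) = map f (sfx k w)"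
  by (simp add: sfx_def drop_map)

lemma invariant_under_sfx_mono:
  "invariant_under A (sfx k) L \<Longrightarrow> k \<le> l \<Longrightarrow> invariant_under A (sfx l) L"
  unfolding invariant_under_def by (metis sfx_sfx)

lemma SU_invariant:
  assumes "L \<in> SU A"
  shows "\<exists>k. invariant_under A (sfx k) L"
  using assms unfolding SU_def
proof (induction rule: boolean_combinations.induct)
  case (gen L)
  then obtain x where x: "x \<in> lists A" "L = {v @ x |v. v \<in> lists A}" by blast
  have "w \<in> L \<longleftrightarrow> sfx (length x) w = x" if "w \<in> lists A" for w
  proof
    assume "sfx (length x) w = x"
    then have "w = take (length w - length x) w @ x"
      by (metis append_take_drop_id sfx_def)
    then show "w \<in> L" using x take_in_lists[OF that] by blast
  qed (auto simp: x sfx_append)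
  then show ?case unfolding invariant_under_def by metis
next
  case (un K L)
  then obtain k l where "invariant_under A (sfx k) K" "invariant_under A (sfx l) L" by blast
  then have "invariant_under A (sfx (k + l)) K" "invariant_under A (sfx (k + l)) L"
    by (auto elim: invariant_under_sfx_mono)
  then show ?case
    using invariant_under_Un by blast
next
  case (int K L)
  then obtain k l where "invariant_under A (sfx k) K" "invariant_under A (sfx l) L" by blast
  then have "invariant_under A (sfx (k + l)) K" "invariant_under A (sfx (k + l)) L"
    by (auto elim: invariant_under_sfx_mono)
  then show ?case
    using invariant_under_Int by blast
next
  case (compl L)
  then show ?case using invariant_under_compl by blast
qed

abbreviation (input) sfx_code :: "nat \<Rightarrow> nat list \<Rightarrow> nat" where
  "sfx_code k w \<equiv> list_encode (sfx k w)"

lemma MOD_fibre: "m < d \<Longrightarrow> {w \<in> lists A. length w mod d = m} \<in> MOD A"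
  unfolding MOD_def by (intro boolean_combinations.gen) blast

lemma SU_suffix: "x \<in> lists A \<Longrightarrow> {v @ x |v. v \<in> lists A} \<in> SU A"
  unfolding SU_def by (intro boolean_combinations.gen) blast

lemma SU_Diff:
  assumes "K \<in> SU A" "L \<in> SU A"
  shows "K - L \<in> SU A"
proof -
  have "K \<inter> (lists A - L) \<in> SU A"
    using assms unfolding SU_def by (intro boolean_combinations.int boolean_combinations.compl)
  moreover have "K \<subseteq> lists A"
    using assms(1) unfolding SU_def by (rule boolean_combinations_subset) auto
  ultimately show ?thesis by (metis Diff_eq Int_assoc Diff_Int_distrib inf.absorb1)
qed

text \<open>For \<open>x\<close> of length \<open>k\<close> the fibre consists of all words ending
  in \<open>x\<close>. A shorter value arises only from the word \<open>x\<close> itself, and the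
  singleton of \<open>x\<close> is what remains of the words ending in \<open>x\<close> after
  removing those ending in \<open>a # x\<close> for some letter \<open>a\<close>.\<close>

lemma SU_fibre:
  assumes A: "finite A" and x: "x \<in> lists A" "length x \<le> k"
  shows "{w \<in> lists A. sfx k w = x} \<in> SU A"
proof (cases "length x = k")
  case True
  have "{w \<in> lists A. sfx k w = x} = {v @ x |v. v \<in> lists A}"
  proof (intro subset_antisym subsetI)
    fix w assume "w \<in> {w \<in> lists A. sfx k w = x}"
    then have "w = take (length w - k) w @ x" "take (length w - k) w \<in> lists A"
      by (auto simp: sfx_def take_in_lists dest: in_set_takeD)
    then show "w \<in> {v @ x |v. v \<in> lists A}" by blast
  qed (use x True in \<open>auto simp: sfx_append\<close>)
  then show ?thesis using SU_suffix x(1) by simp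
next
  case False
  let ?E = "\<lambda>y. {v @ y |v. v \<in> lists A}"
  \<comment> \<open>Boolean combinations are binary, so the finite union over letters is removed one
    letter at a time.\<close>
  have "?E x - (\<Union>a\<in>B. ?E (a # x)) \<in> SU A" if "finite B" "B \<subseteq> A" for B
    using that
  proof induction
    case empty
    then show ?case using SU_suffix x(1) by simp
  next
    case (insert b B)
    then have "(?E x - (\<Union>a\<in>B. ?E (a # x))) - ?E (b # x) \<in> SU A"
      using x(1) by (intro SU_Diff[of "_ - _"] SU_suffix) auto
    moreover have "(?E x - (\<Union>a\<in>B. ?E (a # x))) - ?E (b # x) = ?E x - (\<Union>a\<in>insert b B. ?E (a # x))"
      by blast
    ultimately show ?case by simp
  qed
  from this[OF A order_refl] have "?E x - (\<Union>a\<in>A. ?E (a # x)) \<in> SU A" .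
  also have "?E x - (\<Union>a\<in>A. ?E (a # x)) = {x}"
  proof (intro subset_antisym subsetI)
    fix w assume w: "w \<in> ?E x - (\<Union>a\<in>A. ?E (a # x))"
    then obtain v where v: "w = v @ x" "v \<in> lists A" by blast
    have "v = []"
    proof (cases v rule: rev_cases)
      case (snoc u a)
      then have "w \<in> ?E (a # x)" "a \<in> A" using v by auto
      then show ?thesis using w by blast
    qed
    then show "w \<in> {x}" using v by simp
  qed auto
  also have "{x} = {w \<in> lists A. sfx k w = x}"
  proof -
    have "w = x" if "sfx k w = x" for w
      using that False x(2) by (metis length_sfx min_def sfx_full nat_le_linear)
    then show ?thesis using x by auto
  qed
  finally show ?thesis .
qed

lemma finite_sfx_code: "finite A \<Longrightarrow> finite (sfx_code k ` lists A)"
proof -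
  assume A: "finite A"
  have "sfx k ` lists A \<subseteq> {xs. set xs \<subseteq> A \<and> length xs \<le> k}"
    by (auto simp: sfx_def in_lists_conv_set dest: in_set_dropD)
  then have "finite (sfx k ` lists A)"
    using finite_lists_length_le[OF A] finite_subset by blast
  then have "finite (list_encode ` sfx k ` lists A)" by simp
  then show ?thesis by (simp add: image_image)
qed

lemma finite_length_mod: "d > 0 \<Longrightarrow> finite ((\<lambda>w. length w mod d) ` X)"
  by (rule finite_subset[of _ "{..<d}"]) auto

section \<open>Enrichment by modulo and suffix tags\<close>

lemma representable_mod_imp_enrich:
  assumes "letter_closed C" "finite A" "d > 0" "representable C A (\<lambda>w. length w mod d) L"
  shows "L \<in> (C \<circ>\<^sub>e MOD) A"
  using assms
  by (intro representable_imp_enrich[where f = "\<lambda>w. length w mod d"] finite_length_mod)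
    (auto intro!: MOD_fibre)

lemma representable_sfx_imp_enrich:
  assumes "letter_closed C" "finite A" "representable C A (sfx_code k) L"
  shows "L \<in> (C \<circ>\<^sub>e SU) A"
proof (rule representable_imp_enrich[OF assms finite_sfx_code[OF assms(2)]])
  fix x assume "x \<in> sfx_code k ` lists A"
  then obtain v where v: "v \<in> lists A" "x = sfx_code k v" by blast
  have "{w \<in> lists A. sfx k w = sfx k v} \<in> SU A"
    by (rule SU_fibre) (use assms(2) v drop_in_lists in \<open>auto simp: sfx_def dest: in_set_dropD\<close>)
  then show "{w \<in> lists A. sfx_code k w = x} \<in> SU A"
    using v by (simp add: list_encode_eq)
qed

text \<open>The finitely many fibres of \<open>f\<close> share a modulus \<open>d\<close>, so the
  length modulo \<open>d\<close> determines \<open>f\<close>. Every multiple is offered as well,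
  since moduli of several languages have to be unified later.\<close>

lemma enrich_MOD_representable:
  assumes C: "letter_closed C" and A: "finite A" and L: "L \<in> (C \<circ>\<^sub>e MOD) A"
  obtains d where "d > 0"
    "\<And>e. d dvd e \<Longrightarrow> e > 0 \<Longrightarrow> representable C A (\<lambda>w. length w mod e) L"
proof -
  obtain f where f: "finite (f ` lists A)" "representable C A f L"
    and fib: "\<And>x. x \<in> f ` lists A \<Longrightarrow> {w \<in> lists A. f w = x} \<in> MOD A"
    by (rule enrich_imp_representable[OF C A L]) blast
  have "\<exists>d>0. \<forall>x\<in>X. invariant_under A (\<lambda>w. length w mod d) {w \<in> lists A. f w = x}"
    if "finite X" "X \<subseteq> f ` lists A" for X
    using that
  proof induction
    case (insert x X)
    then obtain d where d: "d > 0"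
      "\<forall>x\<in>X. invariant_under A (\<lambda>w. length w mod d) {w \<in> lists A. f w = x}" by blast
    obtain e where e: "e > 0"
      "\<And>e'. e dvd e' \<Longrightarrow> invariant_under A (\<lambda>w. length w mod e') {w \<in> lists A. f w = x}"
      using MOD_invariant[OF fib[of x]] insert.prems by blast
    show ?case
      using d e invariant_under_mod_mult[of A d _ "d * e"] by (intro exI[of _ "d * e"]) auto
  qed auto
  from this[OF f(1) order_refl] obtain d where d: "d > 0"
    and inv: "\<And>x. x \<in> f ` lists A \<Longrightarrow> invariant_under A (\<lambda>w. length w mod d) {w \<in> lists A. f w = x}"
    by blast
  have eq: "f w = f w'" if "w \<in> lists A" "w' \<in> lists A" "length w mod d = length w' mod d" for w w'
    using invariant_under_fibreD[OF inv[OF imageI]] that by blast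
  have "representable C A (\<lambda>w. length w mod e) L" if "d dvd e" "e > 0" for e
  proof (rule representable_refine[OF C A finite_length_mod[OF that(2)] f(2)])
    fix w w' assume "w \<in> lists A" "w' \<in> lists A" "length w mod e = length w' mod e"
    then show "f w = f w'" using eq mod_mod_cancel[OF that(1)] by metis
  qed
  with d that show thesis by blast
qed

text \<open>As for \<open>MOD\<close>, with the maximum of the suffix lengths in place of a common
  multiple.\<close>

lemma enrich_SU_representable:
  assumes C: "letter_closed C" and A: "finite A" and L: "L \<in> (C \<circ>\<^sub>e SU) A"
  obtains k where "\<And>l. k \<le> l \<Longrightarrow> representable C A (sfx_code l) L"
proof -
  obtain f where f: "finite (f ` lists A)" "representable C A f L"
    and fib: "\<And>x. x \<in> f ` lists A \<Longrightarrow> {w \<in> lists A. f w = x} \<in> SU A"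
    by (rule enrich_imp_representable[OF C A L]) blast
  obtain K where K: "\<And>x. x \<in> f ` lists A \<Longrightarrow> invariant_under A (sfx (K x)) {w \<in> lists A. f w = x}"
    using SU_invariant[OF fib] by metis
  define k where "k = Max (K ` f ` lists A)"
  have inv: "invariant_under A (sfx k) {w \<in> lists A. f w = x}" if "x \<in> f ` lists A" for x
    by (rule invariant_under_sfx_mono[OF K[OF that]])
      (use that f(1) in \<open>auto simp: k_def intro!: Max_ge\<close>)
  have eq: "f w = f w'" if "w \<in> lists A" "w' \<in> lists A" "sfx k w = sfx k w'" for w w'
    using invariant_under_fibreD[OF inv[OF imageI]] that by blast
  have "representable C A (sfx_code l) L" if "k \<le> l" for l
  proof (rule representable_refine[OF C A finite_sfx_code[OF A] f(2)])
    fix w w' assume "w \<in> lists A" "w' \<in> lists A" "sfx_code l w = sfx_code l w'"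
    then show "f w = f w'" using eq sfx_sfx[OF that] by (metis list_encode_eq)
  qed
  with that show thesis by blast
qed

section \<open>Inverse images under maps with bounded left context\<close>

lemma positive_variety_quotientD:
  assumes "positive_variety C" "finite A" "L \<in> C A" "u \<in> lists A"
  shows "{v \<in> lists A. v @ u \<in> L} \<in> C A"
proof -
  have "quotient_closed C" using assms(1) by (simp add: positive_variety_def)
  from this[unfolded quotient_closed_def, rule_format, OF assms(2-4)] show ?thesis by simp
qed

lemma positive_variety_inverseD:
  assumes "positive_variety C" "finite A" "finite B" "word_morphism A B h" "L \<in> C B"
  shows "{w \<in> lists A. h w \<in> L} \<in> C A"
proof -
  have "inverse_morphism_closed C" using assms(1) by (simp add: positive_variety_def)
  from this[unfolded inverse_morphism_closed_def, rule_format, OF assms(2-5)] show ?thesis .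
qed

lemma positive_variety_letter_closed:
  assumes "positive_variety C"
  shows "letter_closed C"
  unfolding letter_closed_def
proof (intro allI impI ballI)
  fix A B :: "nat set" and h L
  assume *: "finite A" "finite B" "h ` A \<subseteq> B" "L \<in> C B"
  have "word_morphism A B (map h)"
    using *(3) by (auto simp: word_morphism_def in_lists_conv_set)
  then show "{w \<in> lists A. map h w \<in> L} \<in> C A"
    by (rule positive_variety_inverseD[OF assms *(1,2) _ *(4)])
qed

lemma enrich_subset_lists: "L \<in> (C \<circ>\<^sub>e D) A \<Longrightarrow> L \<subseteq> lists A"
  unfolding enrich_def liftable_def by blast

lemma snoc_in_lists_iff: "w @ [a] \<in> lists A \<longleftrightarrow> w \<in> lists A \<and> a \<in> A"
  by (auto simp: in_lists_conv_set)

text \<open>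
  Here \<open>\<Theta> w\<close> is the part of the tagged word of \<open>z w\<close> that is settled by the letters read so far, and
  \<open>R w\<close> is the part still pending. The pending part is absorbed by a right quotient.
\<close>

lemma SU_transfer:
  fixes t :: "nat list \<Rightarrow> nat \<Rightarrow> nat"
  assumes C: "positive_variety C" and fin: "finite A'" "finite B"
    and L: "\<And>w. w \<in> lists A \<Longrightarrow> representable C B (sfx_code k) (L w)"
    and \<tau>: "\<And>w. w \<in> lists A \<Longrightarrow> \<tau> w \<in> lists A'" "\<tau> [] = []"
      "\<And>w a. w \<in> lists A \<Longrightarrow> a \<in> A \<Longrightarrow> \<tau> (w @ [a]) = \<tau> w @ [t w a]"
    and z: "\<And>w. w \<in> lists A \<Longrightarrow> z w \<in> lists B"
    and \<Theta>: "\<Theta> [] = []" "\<And>w a. w \<in> lists A \<Longrightarrow> a \<in> A \<Longrightarrow> \<Theta> (w @ [a]) = \<Theta> w @ E w a"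
    and tag: "\<And>w. w \<in> lists A \<Longrightarrow> tag_by (sfx_code k) (z w) = \<Theta> w @ R w"
    and det_E: "\<And>v w a b. v \<in> lists A \<Longrightarrow> w \<in> lists A \<Longrightarrow> a \<in> A \<Longrightarrow> b \<in> A \<Longrightarrow>
      sfx K (\<tau> v) = sfx K (\<tau> w) \<Longrightarrow> t v a = t w b \<Longrightarrow> E v a = E w b"
    and det_R: "\<And>v w. v \<in> lists A \<Longrightarrow> w \<in> lists A \<Longrightarrow> sfx K (\<tau> v) = sfx K (\<tau> w) \<Longrightarrow> R v = R w"
    and det_z: "\<And>v w. v \<in> lists A \<Longrightarrow> w \<in> lists A \<Longrightarrow> sfx K (\<tau> v) = sfx K (\<tau> w) \<Longrightarrow>
      sfx k (z v) = sfx k (z w)"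
    and det_L: "\<And>v w. v \<in> lists A \<Longrightarrow> w \<in> lists A \<Longrightarrow> sfx K (\<tau> v) = sfx K (\<tau> w) \<Longrightarrow> L v = L w"
  shows "\<exists>L'\<in>(C \<circ>\<^sub>e SU) A'. \<forall>w\<in>lists A. \<tau> w \<in> L' \<longleftrightarrow> z w \<in> L w"
proof -
  define rep where "rep M G \<longleftrightarrow> (\<forall>x\<in>sfx_code k ` lists B. G x \<in> C (tag_alphabet (sfx_code k) B)) \<and>
      M = {w \<in> lists B. tag_by (sfx_code k) w \<in> G (sfx_code k w)}" for M G
  \<comment> \<open>The family is chosen as a function of the language, so that \<open>det_L\<close>
    yields equal families for words with equal tagged suffixes.\<close>
  define F where "F M = (SOME G. rep M G)" for M
  have F: "rep (L w) (F (L w))" if "w \<in> lists A" for w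
  proof -
    have "\<exists>G. rep (L w) G"
      using L[OF that] unfolding representable_def rep_def .
    then show ?thesis unfolding F_def by (rule someI_ex)
  qed
  define T where "T = tag_alphabet (sfx_code k) B"
  define T' where "T' = tag_alphabet (sfx_code K) A'"
  have fin_T: "finite T" "finite T'"
    unfolding T_def T'_def by (intro finite_tag_alphabet finite_sfx_code fin)+
  have in_T: "\<Theta> w @ R w \<in> lists T" if "w \<in> lists A" for w
    using tag_by_in_lists[OF z[OF that], of "sfx_code k"] tag[OF that] by (simp add: T_def)
  have E_T: "E w a \<in> lists T" if "w \<in> lists A" "a \<in> A" for w a
    using in_T[of "w @ [a]"] that by (simp add: snoc_in_lists_iff \<Theta>)
  have R_T: "R w \<in> lists T" if "w \<in> lists A" for w
    using in_T[OF that] by simp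
  \<comment> \<open>The output \<open>E w a\<close> is a function of the tagged letter by
    \<open>det_E\<close>. On codes that do not occur the empty word is an arbitrary default, which
    makes the morphism total.\<close>
  have "\<exists>e\<in>lists T. \<forall>w\<in>lists A. \<forall>a\<in>A. n = prod_encode (sfx_code K (\<tau> w), t w a) \<longrightarrow> e = E w a" for n
  proof (cases "\<exists>w\<in>lists A. \<exists>a\<in>A. n = prod_encode (sfx_code K (\<tau> w), t w a)")
    case True
    then obtain w a where "w \<in> lists A" "a \<in> A" "n = prod_encode (sfx_code K (\<tau> w), t w a)" by blast
    then show ?thesis
      by (intro bexI[of _ "E w a"] E_T) (auto simp: prod_encode_eq list_encode_eq intro!: det_E)
  next
    case False
    then show ?thesis by (intro bexI[of _ "[]"]) auto
  qed
  then obtain Em where Em: "\<And>n. Em n \<in> lists T"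
    "\<And>w a. w \<in> lists A \<Longrightarrow> a \<in> A \<Longrightarrow> Em (prod_encode (sfx_code K (\<tau> w), t w a)) = E w a"
    by metis
  have F_T: "F (L w) (sfx_code k (z w)) \<in> C T" if "w \<in> lists A" for w
    unfolding T_def using F[OF that] z[OF that] unfolding rep_def by blast
  \<comment> \<open>Likewise the pending part and the language to be tested are functions of the
    final tag, by \<open>det_R\<close>, \<open>det_z\<close> and \<open>det_L\<close>; defaults are
    taken elsewhere.\<close>
  have "\<exists>r G. r \<in> lists T \<and> G \<in> C T \<and>
      (\<forall>w\<in>lists A. x = sfx_code K (\<tau> w) \<longrightarrow> r = R w \<and> G = F (L w) (sfx_code k (z w)))" for x
  proof (cases "\<exists>w\<in>lists A. x = sfx_code K (\<tau> w)")
    case True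
    then obtain w where w: "w \<in> lists A" "x = sfx_code K (\<tau> w)" by blast
    have "R w = R v \<and> F (L w) (sfx_code k (z w)) = F (L v) (sfx_code k (z v))"
      if "v \<in> lists A" "x = sfx_code K (\<tau> v)" for v
      using det_R[OF w(1) that(1)] det_z[OF w(1) that(1)] det_L[OF w(1) that(1)] w(2) that(2)
      by (simp add: list_encode_eq)
    then show ?thesis
      using R_T[OF w(1)] F_T[OF w(1)] by blast
  next
    case False
    have "[] \<in> lists T" "[] \<in> lists A" by simp_all
    with False F_T show ?thesis by blast
  qed
  then obtain Rm Gm where Rm: "\<And>x. Rm x \<in> lists T" "\<And>x. Gm x \<in> C T"
    "\<And>w. w \<in> lists A \<Longrightarrow> Rm (sfx_code K (\<tau> w)) = R w"
    "\<And>w. w \<in> lists A \<Longrightarrow> Gm (sfx_code K (\<tau> w)) = F (L w) (sfx_code k (z w))"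
    by metis
  \<comment> \<open>This morphism sends the tagged word of \<open>\<tau> w\<close> to the settled
    part \<open>\<Theta> w\<close>.\<close>
  define \<Psi> where "\<Psi> u = concat (map Em u)" for u
  have \<Psi>_T: "\<Psi> u \<in> lists T" for u
    using Em(1) by (induction u) (simp_all add: \<Psi>_def)
  then have \<Psi>: "word_morphism T' T \<Psi>"
    by (simp add: word_morphism_def) (simp add: \<Psi>_def)
  have \<Psi>_tag: "\<Psi> (tag_by (sfx_code K) (\<tau> w)) = \<Theta> w" if "w \<in> lists A" for w
    using that
  proof (induction w rule: rev_induct)
    case Nil
    then show ?case by (simp add: \<tau> \<Theta> \<Psi>_def)
  next
    case (snoc a w)
    then show ?case by (simp add: \<tau> \<Theta> \<Psi>_def snoc_in_lists_iff Em)
  qed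
  \<comment> \<open>Appending the pending part and testing membership amounts to a right quotient
    followed by an inverse image under \<open>\<Psi>\<close>; both operations preserve
    \<open>C\<close>.\<close>
  define F' where "F' x = {u \<in> lists T'. \<Psi> u \<in> {v \<in> lists T. v @ Rm x \<in> Gm x}}" for x
  have F': "F' x \<in> C T'" for x
  proof -
    have "{v \<in> lists T. v @ Rm x \<in> Gm x} \<in> C T"
      by (rule positive_variety_quotientD[OF C fin_T(1) Rm(2,1)])
    then show ?thesis
      unfolding F'_def by (rule positive_variety_inverseD[OF C fin_T(2,1) \<Psi>])
  qed
  define L' where "L' = {u \<in> lists A'. tag_by (sfx_code K) u \<in> F' (sfx_code K u)}"
  have "representable C A' (sfx_code K) L'"
    unfolding representable_def L'_def
    by (rule exI[of _ F'], intro conjI ballI refl) (rule F'[unfolded T'_def])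
  then have "L' \<in> (C \<circ>\<^sub>e SU) A'"
    by (rule representable_sfx_imp_enrich[OF positive_variety_letter_closed[OF C] fin(1)])
  moreover have "\<tau> w \<in> L' \<longleftrightarrow> z w \<in> L w" if w: "w \<in> lists A" for w
  proof -
    have "tag_by (sfx_code K) (\<tau> w) \<in> lists T'"
      unfolding T'_def by (intro tag_by_in_lists \<tau> w)
    moreover have "\<Theta> w \<in> lists T"
      using in_T[OF w] by simp
    moreover have "z w \<in> L w \<longleftrightarrow> tag_by (sfx_code k) (z w) \<in> F (L w) (sfx_code k (z w))"
      using F[OF w] z[OF w] unfolding rep_def by blast
    ultimately show ?thesis
      unfolding L'_def F'_def using w \<tau>(1)[OF w] by (simp add: \<Psi>_tag Rm tag)
  qed
  ultimately show ?thesis by blast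
qed

text \<open>Renaming letters preserves lengths and commutes with taking suffixes, so every letter
  settles its output at once: the transfer applies with nothing pending and the same suffix
  length.\<close>

lemma letter_closed_enrich_SU:
  assumes C: "positive_variety C"
  shows "letter_closed (C \<circ>\<^sub>e SU)"
  unfolding letter_closed_def
proof (intro allI impI ballI)
  fix A B :: "nat set" and h L
  assume *: "finite A" "finite B" "h ` A \<subseteq> B" "L \<in> (C \<circ>\<^sub>e SU) B"
  obtain k where k: "representable C B (sfx_code k) L"
    by (rule enrich_SU_representable[OF positive_variety_letter_closed[OF C] *(2,4)]) blast
  have "\<exists>L'\<in>(C \<circ>\<^sub>e SU) A. \<forall>w\<in>lists A. w \<in> L' \<longleftrightarrow> map h w \<in> L"
  proof (rule SU_transfer[OF C *(1,2) k, where t = "\<lambda>_ a. a" and R = "\<lambda>_. []" and K = k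
        and \<Theta> = "\<lambda>w. tag_by (sfx_code k) (map h w)"
        and E = "\<lambda>w a. [prod_encode (sfx_code k (map h w), h a)]"])
    show "map h w \<in> lists B" if "w \<in> lists A" for w
      using that *(3) by (auto simp: in_lists_conv_set)
  qed (simp_all add: sfx_map)
  then obtain L' where L': "L' \<in> (C \<circ>\<^sub>e SU) A" "\<And>w. w \<in> lists A \<Longrightarrow> w \<in> L' \<longleftrightarrow> map h w \<in> L"
    by blast
  have "{w \<in> lists A. map h w \<in> L} = L'"
    using L'(2) enrich_subset_lists[OF L'(1)] by blast
  then show "{w \<in> lists A. map h w \<in> L} \<in> (C \<circ>\<^sub>e SU) A"
    using L'(1) by simp
qed

section \<open>Substituting blocks of letters\<close>

abbreviation (input) len_mod :: "nat \<Rightarrow> 'a list \<Rightarrow> nat" where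
  "len_mod d w \<equiv> length w mod d"

text \<open>Tagged words reveal the underlying word and the initial tag. With \<open>f\<close>
  shifted by a prefix, the initial tag is the residue of the length of that prefix.\<close>

lemma tag_by_eqD:
  assumes "tag_by f u = tag_by g v"
  shows "u = v" "u \<noteq> [] \<Longrightarrow> f [] = g []"
proof -
  have len: "length u = length v" using assms by (metis length_tag_by)
  have nth: "tag_by f u ! i = prod_encode (f (take i u), u ! i)" if "i < length u" for f u i
    using that by (simp add: tag_by_def)
  show "u = v"
    by (rule nth_equalityI[OF len]) (metis assms len nth prod_encode_eq prod.inject)
  show "f [] = g []" if "u \<noteq> []"
  proof -
    have "v \<noteq> []" using that len by auto
    then show ?thesis using nth[of 0 u f] nth[of 0 v g] that assms by (simp add: prod_encode_eq)
  qed
qed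

locale block_substitution =
  fixes s d :: nat and A :: "nat set" and \<rho> :: "nat list \<Rightarrow> nat list"
  assumes pos: "0 < s" "0 < d" and dvd: "s dvd d"
    and \<rho>: "\<And>b. b \<in> lists A \<Longrightarrow> length b = s \<Longrightarrow> \<rho> b \<in> lists A \<and> length (\<rho> b) = d"
begin

text \<open>A transducer that buffers letters until a block of length \<open>s\<close> is complete
  and then emits its image under \<open>\<rho>\<close>.\<close>

definition step :: "nat list \<times> nat list \<Rightarrow> nat \<Rightarrow> nat list \<times> nat list" where
  "step = (\<lambda>(out, buf) a.
     if Suc (length buf) = s then (out @ \<rho> (buf @ [a]), []) else (out, buf @ [a]))"

definition out :: "nat list \<Rightarrow> nat list" where
  "out w = fst (foldl step ([], []) w)"

definition pend :: "nat list \<Rightarrow> nat list" where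
  "pend w = snd (foldl step ([], []) w)"

definition subst :: "nat list \<Rightarrow> nat list" where
  "subst w = out w @ pend w"

lemma out_Nil [simp]: "out [] = []" and pend_Nil [simp]: "pend [] = []"
  by (simp_all add: out_def pend_def)

lemma out_snoc:
    "out (w @ [a]) = (if Suc (length (pend w)) = s then out w @ \<rho> (pend w @ [a]) else out w)"
  and pend_snoc:
    "pend (w @ [a]) = (if Suc (length (pend w)) = s then [] else pend w @ [a])"
  by (simp_all add: out_def pend_def step_def split: prod.split)

lemma length_pend [simp]: "length (pend w) = length w mod s"
  by (induction w rule: rev_induct) (use pos in \<open>auto simp: pend_snoc mod_Suc\<close>)

lemma pend_in_lists: "w \<in> lists A \<Longrightarrow> pend w \<in> lists A"
  by (induction w rule: rev_induct) (auto simp: pend_snoc)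

lemma out_in_lists: "w \<in> lists A \<Longrightarrow> out w \<in> lists A \<and> length (out w) = d * (length w div s)"
proof (induction w rule: rev_induct)
  case (snoc a w)
  then have "pend w @ [a] \<in> lists A" by (simp add: pend_in_lists)
  then show ?case
    using snoc \<rho>[of "pend w @ [a]"] by (auto simp: out_snoc div_Suc mod_Suc)
qed simp

lemma subst_in_lists: "w \<in> lists A \<Longrightarrow> subst w \<in> lists A"
  by (simp add: subst_def out_in_lists pend_in_lists)

text \<open>Finished blocks contribute a multiple of \<open>d\<close>, and the unfinished one has
  length \<open>length w mod s\<close>, which is below \<open>d\<close> because
  \<open>s dvd d\<close>.\<close>

lemma length_subst_mod: "w \<in> lists A \<Longrightarrow> length (subst w) mod d = length w mod s"
proof -
  assume "w \<in> lists A"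
  then have "length (subst w) = d * (length w div s) + length w mod s"
    by (simp add: subst_def out_in_lists)
  moreover have "length w mod s < d"
    using pos dvd by (meson dvd_imp_le less_le_trans mod_less_divisor)
  ultimately show ?thesis by simp
qed

lemma out_pend_append:
  assumes "s dvd length p"
  shows "out (p @ q) = out p @ out q" "pend (p @ q) = pend q"
proof -
  \<comment> \<open>Output is only ever appended, so the transducer started with an empty buffer
    after \<open>p\<close> behaves as if started afresh.\<close>
  have gen: "foldl step (x @ y, b) q = (x @ fst (foldl step (y, b) q), snd (foldl step (y, b) q))"
    for x y b
    by (induction q arbitrary: y b) (simp_all add: step_def)
  have "pend p = []" using assms by (metis length_0_conv length_pend dvd_imp_mod_0)
  then have "foldl step ([], []) p = (out p, [])"
    by (simp add: out_def pend_def prod_eq_iff)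
  then show "out (p @ q) = out p @ out q" "pend (p @ q) = pend q"
    using gen[of "out p" "[]" "[]"] by (simp_all add: out_def pend_def)
qed

lemma tag_out_append:
  assumes "w \<in> lists A"
  shows "tag_by (len_mod d) (out w @ u) = tag_by (len_mod d) (out w) @ tag_by (len_mod d) u"
  using out_in_lists[OF assms] by (simp add: tag_by_append)

text \<open>The tags in a window of \<open>s * Suc k\<close> letters show where blocks begin. From
  the first boundary after the start of the window at least \<open>k\<close> whole blocks remain,
  each with nonempty image, so the last \<open>k\<close> letters of output and the unfinished block
  come from the window alone. Words shorter than the window are known completely.\<close>

lemma sfx_determines:
  assumes vw: "v \<in> lists A" "w \<in> lists A"
    and eq: "sfx (s * Suc k) (tag_by (len_mod s) v) = sfx (s * Suc k) (tag_by (len_mod s) w)"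
  shows "pend v = pend w"
    and "sfx k (tag_by (len_mod d) (out v)) = sfx k (tag_by (len_mod d) (out w))"
    and "length v mod s = length w mod s"
proof -
  let ?K = "s * Suc k"
  have len: "min ?K (length v) = min ?K (length w)"
    using arg_cong[OF eq, of length] by simp
  have "pend v = pend w \<and> length v mod s = length w mod s \<and>
      sfx k (tag_by (len_mod d) (out v)) = sfx k (tag_by (len_mod d) (out w))"
  proof (cases "?K \<le> length v")
    case False
    then have "tag_by (len_mod s) v = tag_by (len_mod s) w"
      using eq len by (simp add: min_def split: if_splits)
    then show ?thesis using tag_by_eqD(1) by blast
  next
    case True
    define cut where "cut w = take (length w - ?K) w" for w :: "nat list"
    define rest where "rest w = drop (length w - ?K) w" for w :: "nat list"
    have split: "u = cut u @ rest u" for u by (simp add: cut_def rest_def)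
    have lens: "length (rest v) = ?K" "length (rest w) = ?K"
      using True len by (auto simp: rest_def)
    have sfx_rest: "sfx ?K (tag_by (len_mod s) u) = tag_by (\<lambda>x. len_mod s (cut u @ x)) (rest u)"
      if "length (rest u) = ?K" for u
      by (subst split, subst tag_by_append, subst sfx_append) (use that in simp_all)
    have "tag_by (\<lambda>x. len_mod s (cut v @ x)) (rest v) = tag_by (\<lambda>x. len_mod s (cut w @ x)) (rest w)"
      using eq lens by (simp only: sfx_rest)
    from tag_by_eqD[OF this] have rest: "rest v = rest w"
      and cut: "len_mod s (cut v) = len_mod s (cut w)"
      using lens pos by fastforce+
    \<comment> \<open>The distance to the next block boundary. If the window starts on a boundary,
      this is \<open>s\<close> and not 0; the extra block in \<open>s * Suc k\<close> covers that
      case.\<close>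
    define r where "r = s - len_mod s (cut v)"
    define x where "x = drop r (rest v)"
    have r: "r \<le> s" by (simp add: r_def)
    have x: "s * k \<le> length x" using lens r by (simp add: x_def)
    have main: "pend u = pend x \<and> length u mod s = length x mod s \<and>
        sfx k (tag_by (len_mod d) (out u)) = sfx k (tag_by (len_mod d) (out x))"
      if u: "u \<in> lists A" "rest u = rest v" "len_mod s (cut u) = len_mod s (cut v)" for u
    proof -
      define p where "p = cut u @ take r (rest u)"
      have up: "u = p @ x"
        using split[of u] u by (simp add: p_def x_def)
      have lp: "length p = length (cut u) + (s - len_mod s (cut u))"
        using u r lens by (simp add: p_def r_def)
      have "length (cut u) = s * (length (cut u) div s) + len_mod s (cut u)" by simp
      then have "length p = s * (length (cut u) div s) + s"
        unfolding lp using pos by (metis add.assoc le_add_diff_inverse less_imp_le mod_less_divisor)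
      then have p: "s dvd length p" by simp
      have in_A: "p \<in> lists A" "x \<in> lists A" using u(1) up by simp_all
      have "k \<le> length x div s"
        using x pos by (metis div_le_mono nonzero_mult_div_cancel_left less_not_refl)
      also have "\<dots> \<le> length (out x)" using out_in_lists[OF in_A(2)] pos by simp
      finally have "sfx k (tag_by (len_mod d) (out u)) = sfx k (tag_by (len_mod d) (out x))"
        unfolding up out_pend_append(1)[OF p] tag_out_append[OF in_A(1)] by (simp add: sfx_append)
      moreover have "length u mod s = length x mod s"
        using p unfolding up by (metis dvd_imp_mod_0 length_append mod_add_left_eq add_0)
      ultimately show ?thesis
        using out_pend_append(2)[OF p] up by simp
    qed
    from main[OF vw(1)] main[OF vw(2) rest[symmetric] cut[symmetric]] show ?thesis by simp
  qed
  then show "pend v = pend w" "length v mod s = length w mod s"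
    "sfx k (tag_by (len_mod d) (out v)) = sfx k (tag_by (len_mod d) (out w))" by blast+
qed

text \<open>The transfer is applied to the substituted word tagged modulo \<open>d\<close>, with the
  finished blocks as settled part and the buffer as pending part. The language to be tested varies
  with the residue of the length, which is why the transfer admits a language depending on
  \<open>w\<close>.\<close>

lemma enrich_MOD_transfer:
  assumes C: "positive_variety C" and A: "finite A"
    and L: "representable (C \<circ>\<^sub>e SU) A (len_mod d) L"
  shows "\<exists>L'\<in>(C \<circ>\<^sub>e SU) (tag_alphabet (len_mod s) A).
    \<forall>w\<in>lists A. tag_by (len_mod s) w \<in> L' \<longleftrightarrow> subst w \<in> L"
proof -
  let ?B = "tag_alphabet (len_mod d) A"
  have fin: "finite ?B" "finite (tag_alphabet (len_mod s) A)"
    by (intro finite_tag_alphabet A finite_length_mod pos)+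
  obtain F where F: "\<And>x. x \<in> len_mod d ` lists A \<Longrightarrow> F x \<in> (C \<circ>\<^sub>e SU) ?B"
    and L_eq: "L = {w \<in> lists A. tag_by (len_mod d) w \<in> F (len_mod d w)}"
    using L unfolding representable_def by blast
  have "\<exists>k. \<forall>l\<ge>k. representable C ?B (sfx_code l) (F x)" if "x \<in> len_mod d ` lists A" for x
    using enrich_SU_representable[OF positive_variety_letter_closed[OF C] fin(1) F[OF that]] by metis
  then obtain \<kappa> where \<kappa>: "\<And>x l. x \<in> len_mod d ` lists A \<Longrightarrow> \<kappa> x \<le> l \<Longrightarrow>
      representable C ?B (sfx_code l) (F x)"
    by metis
  \<comment> \<open>One suffix length for all residues modulo \<open>d\<close>, of which there are
    finitely many.\<close>
  define k where "k = Max (\<kappa> ` len_mod d ` lists A)"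
  have k: "representable C ?B (sfx_code k) (F x)" if "x \<in> len_mod d ` lists A" for x
    by (rule \<kappa>[OF that]) (use that finite_length_mod[OF pos(2)] in \<open>auto simp: k_def intro!: Max_ge\<close>)
  define X where "X w = tag_by (len_mod d) (out w)" for w
  \<comment> \<open>The suffix tags of a factor \<open>u\<close> placed after the finished output;
    they depend on that output only through its last \<open>k\<close> tagged letters. The inner tags
    restart in \<open>u\<close>, as the length of \<open>out w\<close> is a multiple of
    \<open>d\<close>.\<close>
  define ctx where "ctx w u = tag_by (\<lambda>x. sfx_code k (X w @ x)) (tag_by (len_mod d) u)" for w u
  have "\<exists>L'\<in>(C \<circ>\<^sub>e SU) (tag_alphabet (len_mod s) A).
    \<forall>w\<in>lists A. tag_by (len_mod s) w \<in> L' \<longleftrightarrow>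
      tag_by (len_mod d) (subst w) \<in> F (len_mod d (subst w))"
  proof (rule SU_transfer[OF C fin(2,1), where k = k and K = "s * Suc k"
        and t = "\<lambda>w a. prod_encode (len_mod s w, a)"
        and \<Theta> = "\<lambda>w. tag_by (sfx_code k) (X w)" and R = "\<lambda>w. ctx w (pend w)"
        and E = "\<lambda>w a. if Suc (length (pend w)) = s then ctx w (\<rho> (pend w @ [a])) else []"])
    fix w assume w: "w \<in> lists A"
    show "representable C ?B (sfx_code k) (F (len_mod d (subst w)))"
      by (intro k imageI subst_in_lists w)
    show "tag_by (len_mod s) w \<in> lists (tag_alphabet (len_mod s) A)"
      by (rule tag_by_in_lists[OF w])
    show "tag_by (len_mod d) (subst w) \<in> lists ?B"
      by (intro tag_by_in_lists subst_in_lists w)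
    show "tag_by (sfx_code k) (tag_by (len_mod d) (subst w)) =
        tag_by (sfx_code k) (X w) @ ctx w (pend w)"
      unfolding subst_def tag_out_append[OF w] X_def ctx_def by (rule tag_by_append)
    fix a assume "a \<in> A"
    show "tag_by (sfx_code k) (X (w @ [a])) = tag_by (sfx_code k) (X w) @
        (if Suc (length (pend w)) = s then ctx w (\<rho> (pend w @ [a])) else [])"
      unfolding X_def ctx_def by (simp add: out_snoc tag_out_append[OF w] tag_by_append[where f = "sfx_code k"] del: length_pend)
  next
    fix v w assume *: "v \<in> lists A" "w \<in> lists A"
      "sfx (s * Suc k) (tag_by (len_mod s) v) = sfx (s * Suc k) (tag_by (len_mod s) w)"
    note det = sfx_determines[OF *]
    have "ctx v = ctx w"
      unfolding ctx_def X_def using sfx_append_cong[OF det(2)] by (intro ext) metis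
    then show "ctx v (pend v) = ctx w (pend w)"
      and "\<And>a b. prod_encode (len_mod s v, a) = prod_encode (len_mod s w, b) \<Longrightarrow>
        (if Suc (length (pend v)) = s then ctx v (\<rho> (pend v @ [a])) else []) =
        (if Suc (length (pend w)) = s then ctx w (\<rho> (pend w @ [b])) else [])"
      using det(1) by (simp_all add: prod_encode_eq del: length_pend)
    show "sfx k (tag_by (len_mod d) (subst v)) = sfx k (tag_by (len_mod d) (subst w))"
      unfolding subst_def tag_out_append[OF *(1)] tag_out_append[OF *(2)] det(1)
      by (rule sfx_append_cong[OF det(2)])
    show "F (len_mod d (subst v)) = F (len_mod d (subst w))"
      using det(3) by (simp add: length_subst_mod *(1,2))
  qed (simp_all add: X_def)
  then show ?thesis
    unfolding L_eq using subst_in_lists by blast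
qed

end

text \<open>Reading letter by letter, the congruence property allows a completed block to be
  exchanged for its image without changing \<open>\<beta>\<close>.\<close>

lemma block_substitution_invariant:
  assumes "block_substitution s d A \<rho>" and w: "w \<in> lists A"
    and cong: "\<And>u u' v v'. \<beta> u = \<beta> u' \<Longrightarrow> \<beta> v = \<beta> v' \<Longrightarrow> \<beta> (u @ v) = \<beta> (u' @ v')"
    and \<rho>_\<beta>: "\<And>b. b \<in> lists A \<Longrightarrow> length b = s \<Longrightarrow> \<beta> (\<rho> b) = \<beta> b"
  shows "\<beta> (block_substitution.subst s \<rho> w) = \<beta> w"
proof -
  interpret block_substitution s d A \<rho> by fact
  show ?thesis
    using w
  proof (induction w rule: rev_induct)
    case Nil
    then show ?case by (simp add: subst_def)
  next
    case (snoc a w)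
    then have "\<beta> (out w @ pend w @ [a]) = \<beta> (w @ [a])"
      using cong[of "out w @ pend w" w "[a]" "[a]"] by (simp add: subst_def)
    moreover have "\<beta> (out w @ \<rho> (pend w @ [a])) = \<beta> (out w @ pend w @ [a])"
      if "Suc (length (pend w)) = s"
      using that snoc.prems by (intro cong \<rho>_\<beta> refl) (simp_all add: pend_in_lists)
    ultimately show ?case by (simp add: subst_def out_snoc pend_snoc del: length_pend)
  qed
qed

text \<open>
  Every word of length \<open>s\<close> behaves like words of all lengths that are positive multiples of \<open>s\<close>, so
  a finer modulus than \<open>s\<close> gives no additional power.
\<close>

locale stable_length =
  fixes s :: nat and A :: "nat set" and \<beta> :: "nat list \<Rightarrow> 'b"
  assumes s_pos: "0 < s" and finite_A: "finite A"
    and cong: "\<beta> u = \<beta> u' \<Longrightarrow> \<beta> v = \<beta> v' \<Longrightarrow> \<beta> (u @ v) = \<beta> (u' @ v')"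
    and stable: "0 < c \<Longrightarrow> b \<in> lists A \<Longrightarrow> length b = s \<Longrightarrow>
      \<exists>b'\<in>lists A. length b' = s * c \<and> \<beta> b' = \<beta> b"
begin

abbreviation "\<tau> \<equiv> tag_by (len_mod s)"
abbreviation "A' \<equiv> tag_alphabet (len_mod s) A"

definition saturated :: "nat list set \<Rightarrow> bool" where
  "saturated L \<longleftrightarrow> L \<subseteq> lists A \<and> invariant_under A \<beta> L"

text \<open>One substitution \<open>\<sigma>\<close> must serve the whole family: to cover
  \<open>\<tau> w\<close>, some member containing the single word \<open>\<sigma> w\<close> is
  looked up. Hence a common modulus is taken first.\<close>

lemma ex_transfer:
  assumes C: "positive_variety C" and K: "finite \<K>" "\<K> \<subseteq> ((C \<circ>\<^sub>e SU) \<circ>\<^sub>e MOD) A"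
  obtains \<sigma> T where "\<And>w. w \<in> lists A \<Longrightarrow> \<sigma> w \<in> lists A \<and> \<beta> (\<sigma> w) = \<beta> w"
    "\<And>K. K \<in> \<K> \<Longrightarrow> T K \<in> (C \<circ>\<^sub>e SU) A'"
    "\<And>K w. K \<in> \<K> \<Longrightarrow> w \<in> lists A \<Longrightarrow> \<tau> w \<in> T K \<longleftrightarrow> \<sigma> w \<in> K"
proof -
  note closed = letter_closed_enrich_SU[OF C]
  have "\<exists>d>0. \<forall>K\<in>\<K>. \<forall>e>0. d dvd e \<longrightarrow> representable (C \<circ>\<^sub>e SU) A (len_mod e) K"
    using K
  proof (induction rule: finite_induct)
    case (insert K \<K>)
    then obtain d where d: "d > 0"
      "\<forall>K\<in>\<K>. \<forall>e>0. d dvd e \<longrightarrow> representable (C \<circ>\<^sub>e SU) A (len_mod e) K" by auto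
    obtain d' where d': "d' > 0"
      "\<And>e. d' dvd e \<Longrightarrow> e > 0 \<Longrightarrow> representable (C \<circ>\<^sub>e SU) A (len_mod e) K"
      by (rule enrich_MOD_representable[OF closed finite_A, of K]) (use insert.prems in auto)
    have "representable (C \<circ>\<^sub>e SU) A (len_mod e) M"
      if "M \<in> insert K \<K>" "e > 0" "d * d' dvd e" for M e
      using that(1) d(2) d'(2) that(2) dvd_mult_left[OF that(3)] dvd_mult_right[OF that(3)] by blast
    then show ?case
      using d(1) d'(1) by (intro exI[of _ "d * d'"]) simp
  qed auto
  then obtain c where c: "c > 0"
    "\<And>K e. K \<in> \<K> \<Longrightarrow> e > 0 \<Longrightarrow> c dvd e \<Longrightarrow> representable (C \<circ>\<^sub>e SU) A (len_mod e) K" by blast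
  \<comment> \<open>A multiple of \<open>c\<close>, so that the family is representable modulo
    \<open>d\<close>, and of \<open>s\<close>, so that the blocks stay aligned; stability supplies
    block images of exactly this length.\<close>
  define d where "d = s * c"
  have d: "0 < d" "s dvd d" "c dvd d" using c s_pos by (simp_all add: d_def)
  have "\<exists>b'. b \<in> lists A \<and> length b = s \<longrightarrow> b' \<in> lists A \<and> length b' = d \<and> \<beta> b' = \<beta> b" for b
    using stable[OF c(1)] unfolding d_def by blast
  then obtain \<rho> where \<rho>_\<beta>: "\<And>b. b \<in> lists A \<Longrightarrow> length b = s \<Longrightarrow>
      \<rho> b \<in> lists A \<and> length (\<rho> b) = d \<and> \<beta> (\<rho> b) = \<beta> b"
    by metis
  interpret block_substitution s d A \<rho>
    by unfold_locales (use s_pos d \<rho>_\<beta> in auto)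
  have "\<exists>L'\<in>(C \<circ>\<^sub>e SU) A'. \<forall>w\<in>lists A. \<tau> w \<in> L' \<longleftrightarrow> subst w \<in> K" if "K \<in> \<K>" for K
    by (rule enrich_MOD_transfer[OF C finite_A c(2)[OF that d(1,3)]])
  then obtain T where T: "\<And>K. K \<in> \<K> \<Longrightarrow> T K \<in> (C \<circ>\<^sub>e SU) A'"
    "\<And>K w. K \<in> \<K> \<Longrightarrow> w \<in> lists A \<Longrightarrow> \<tau> w \<in> T K \<longleftrightarrow> subst w \<in> K"
    by metis
  show thesis
  proof (rule that[of subst T])
    show "subst w \<in> lists A \<and> \<beta> (subst w) = \<beta> w" if "w \<in> lists A" for w
      using block_substitution_invariant[OF block_substitution_axioms that, of \<beta>] cong \<rho>_\<beta>
        subst_in_lists[OF that] by blast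
  qed (use T in auto)
qed

text \<open>The same language \<open>K\<close> is used on every residue block.\<close>

lemma inverse_tag_in_enrich:
  assumes C: "positive_variety C" and K: "K \<in> (C \<circ>\<^sub>e SU) A'"
  shows "{w \<in> lists A. \<tau> w \<in> K} \<in> ((C \<circ>\<^sub>e SU) \<circ>\<^sub>e MOD) A"
  by (rule representable_mod_imp_enrich[OF letter_closed_enrich_SU[OF C] finite_A s_pos])
    (unfold representable_def, rule exI[of _ "\<lambda>_. K"], use K in simp)

text \<open>Forwards, \<open>\<sigma>\<close> keeps each word inside the saturated languages it
  belongs to, so \<open>T\<close> carries both covering and disjointness over to the tagged
  languages. Backwards, inverse images under \<open>\<tau>\<close> do.\<close>

lemma coverable_iff:
  assumes C: "positive_variety C" and sat: "saturated L" "\<And>M. M \<in># Ls \<Longrightarrow> saturated M"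
  shows "coverable ((C \<circ>\<^sub>e SU) \<circ>\<^sub>e MOD) A L Ls \<longleftrightarrow>
    coverable (C \<circ>\<^sub>e SU) A' (\<tau> ` L) (image_mset ((`) \<tau>) Ls)"
proof
  assume "coverable ((C \<circ>\<^sub>e SU) \<circ>\<^sub>e MOD) A L Ls"
  then obtain \<K> where \<K>: "finite \<K>" "\<K> \<subseteq> ((C \<circ>\<^sub>e SU) \<circ>\<^sub>e MOD) A" "L \<subseteq> \<Union>\<K>"
    "\<forall>K\<in>\<K>. \<exists>M\<in>#Ls. K \<inter> M = {}"
    unfolding coverable_def by (elim exE conjE)
  obtain \<sigma> T where \<sigma>: "\<And>w. w \<in> lists A \<Longrightarrow> \<sigma> w \<in> lists A \<and> \<beta> (\<sigma> w) = \<beta> w"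
    and T: "\<And>K. K \<in> \<K> \<Longrightarrow> T K \<in> (C \<circ>\<^sub>e SU) A'"
      "\<And>K w. K \<in> \<K> \<Longrightarrow> w \<in> lists A \<Longrightarrow> \<tau> w \<in> T K \<longleftrightarrow> \<sigma> w \<in> K"
    by (rule ex_transfer[OF C \<K>(1,2)]) blast
  have \<sigma>_sat: "w \<in> lists A \<and> \<sigma> w \<in> M" if "saturated M" "w \<in> M" for M w
    using that \<sigma>[of w] unfolding saturated_def invariant_under_def by blast
  show "coverable (C \<circ>\<^sub>e SU) A' (\<tau> ` L) (image_mset ((`) \<tau>) Ls)"
    unfolding coverable_def
  proof (intro exI[of _ "T ` \<K>"] conjI ballI)
    show "finite (T ` \<K>)" "T ` \<K> \<subseteq> (C \<circ>\<^sub>e SU) A'" using \<K>(1) T(1) by auto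
    show "\<tau> ` L \<subseteq> \<Union> (T ` \<K>)"
    proof (rule image_subsetI)
      fix w assume "w \<in> L"
      note w = \<sigma>_sat[OF sat(1) this]
      then obtain K where K: "K \<in> \<K>" "\<sigma> w \<in> K" using \<K>(3) by blast
      then have "\<tau> w \<in> T K" using T(2)[OF K(1)] w by simp
      then show "\<tau> w \<in> \<Union> (T ` \<K>)" using K(1) by blast
    qed
    fix K' assume "K' \<in> T ` \<K>"
    then obtain K where K: "K \<in> \<K>" "K' = T K" by blast
    obtain M where M: "M \<in># Ls" "K \<inter> M = {}" using bspec[OF \<K>(4) K(1)] by blast
    have "\<tau> w \<notin> T K" if "w \<in> M" for w
    proof -
      note w = \<sigma>_sat[OF sat(2)[OF M(1)] that]
      then have "\<sigma> w \<notin> K" using M(2) by blast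
      then show ?thesis using T(2)[OF K(1)] w by simp
    qed
    then have "K' \<inter> \<tau> ` M = {}" using K(2) by blast
    then show "\<exists>M\<in>#image_mset ((`) \<tau>) Ls. K' \<inter> M = {}"
      using M(1) by auto
  qed
next
  assume "coverable (C \<circ>\<^sub>e SU) A' (\<tau> ` L) (image_mset ((`) \<tau>) Ls)"
  then obtain \<K> where \<K>: "finite \<K>" "\<K> \<subseteq> (C \<circ>\<^sub>e SU) A'" "\<tau> ` L \<subseteq> \<Union>\<K>"
    "\<forall>K\<in>\<K>. \<exists>M\<in>#image_mset ((`) \<tau>) Ls. K \<inter> M = {}"
    unfolding coverable_def by (elim exE conjE)
  have disj: "\<exists>M\<in>#Ls. K \<inter> \<tau> ` M = {}" if "K \<in> \<K>" for K
    using bspec[OF \<K>(4) that] by auto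
  show "coverable ((C \<circ>\<^sub>e SU) \<circ>\<^sub>e MOD) A L Ls"
    unfolding coverable_def
  proof (intro exI[of _ "(\<lambda>K. {w \<in> lists A. \<tau> w \<in> K}) ` \<K>"] conjI ballI)
    show "(\<lambda>K. {w \<in> lists A. \<tau> w \<in> K}) ` \<K> \<subseteq> ((C \<circ>\<^sub>e SU) \<circ>\<^sub>e MOD) A"
      using \<K>(2) inverse_tag_in_enrich[OF C] by blast
    show "L \<subseteq> \<Union> ((\<lambda>K. {w \<in> lists A. \<tau> w \<in> K}) ` \<K>)"
    proof
      fix w assume "w \<in> L"
      then have "w \<in> lists A" "\<tau> w \<in> \<Union>\<K>"
        using sat(1) \<K>(3) unfolding saturated_def by auto
      then show "w \<in> \<Union> ((\<lambda>K. {w \<in> lists A. \<tau> w \<in> K}) ` \<K>)" by simp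
    qed
    show "\<exists>M\<in>#Ls. K' \<inter> M = {}" if K': "K' \<in> (\<lambda>K. {w \<in> lists A. \<tau> w \<in> K}) ` \<K>" for K'
    proof -
      obtain K where K: "K \<in> \<K>" "K' = {w \<in> lists A. \<tau> w \<in> K}" using K' by blast
      obtain M where "M \<in># Ls" "K \<inter> \<tau> ` M = {}" using disj[OF K(1)] by blast
      then show ?thesis unfolding K(2) by (intro bexI[of _ M]) auto
    qed
  qed (use \<K>(1) in simp)
qed

text \<open>Deduction from \<open>coverable_iff\<close> would require merging a finite cover into
  one language; translating the single separator both ways avoids this.\<close>

lemma separable_iff:
  assumes C: "positive_variety C" and sat: "saturated L" "saturated M"
  shows "separable ((C \<circ>\<^sub>e SU) \<circ>\<^sub>e MOD) A L M \<longleftrightarrow> separable (C \<circ>\<^sub>e SU) A' (\<tau> ` L) (\<tau> ` M)"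
proof
  assume "separable ((C \<circ>\<^sub>e SU) \<circ>\<^sub>e MOD) A L M"
  then obtain K where K: "K \<in> ((C \<circ>\<^sub>e SU) \<circ>\<^sub>e MOD) A" "L \<subseteq> K" "K \<inter> M = {}"
    unfolding separable_def by blast
  obtain \<sigma> T where \<sigma>: "\<And>w. w \<in> lists A \<Longrightarrow> \<sigma> w \<in> lists A \<and> \<beta> (\<sigma> w) = \<beta> w"
    and T: "\<And>K'. K' \<in> {K} \<Longrightarrow> T K' \<in> (C \<circ>\<^sub>e SU) A'"
      "\<And>K' w. K' \<in> {K} \<Longrightarrow> w \<in> lists A \<Longrightarrow> \<tau> w \<in> T K' \<longleftrightarrow> \<sigma> w \<in> K'"
    by (rule ex_transfer[OF C, of "{K}"]) (use K(1) in blast)+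
  have \<sigma>_sat: "w \<in> lists A \<and> \<sigma> w \<in> N" if "saturated N" "w \<in> N" for N w
    using that \<sigma>[of w] unfolding saturated_def invariant_under_def by blast
  have "\<tau> ` L \<subseteq> T K \<and> T K \<inter> \<tau> ` M = {}"
  proof (intro conjI image_subsetI disjoint_iff[THEN iffD2] allI impI notI)
    fix w assume "w \<in> L"
    then show "\<tau> w \<in> T K" using \<sigma>_sat[OF sat(1)] T(2)[of K w] K(2) by auto
  next
    fix u assume "u \<in> T K" "u \<in> \<tau> ` M"
    then obtain w where "w \<in> M" "\<tau> w \<in> T K" by auto
    then show False using \<sigma>_sat[OF sat(2)] T(2)[of K w] K(3) by auto
  qed
  then show "separable (C \<circ>\<^sub>e SU) A' (\<tau> ` L) (\<tau> ` M)"
    unfolding separable_def using T(1) by blast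
next
  assume "separable (C \<circ>\<^sub>e SU) A' (\<tau> ` L) (\<tau> ` M)"
  then obtain K where K: "K \<in> (C \<circ>\<^sub>e SU) A'" "\<tau> ` L \<subseteq> K" "K \<inter> \<tau> ` M = {}"
    unfolding separable_def by blast
  then have "L \<subseteq> {w \<in> lists A. \<tau> w \<in> K}" "{w \<in> lists A. \<tau> w \<in> K} \<inter> M = {}"
    using sat(1) unfolding saturated_def by auto
  then show "separable ((C \<circ>\<^sub>e SU) \<circ>\<^sub>e MOD) A L M"
    unfolding separable_def using inverse_tag_in_enrich[OF C K(1)] by blast
qed

end

section \<open>Behaviours of automata\<close>

text \<open>The orbit of \<open>x\<close> becomes periodic after \<open>i\<close> steps with some
  period \<open>p\<close>, both at most \<open>N\<close>. Now \<open>fact N\<close> is at least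
  \<open>i\<close> and divisible by \<open>p\<close>, so going from \<open>fact N\<close> to
  \<open>fact N * c\<close> adds whole periods.\<close>

lemma funpow_fact_mult:
  assumes X: "finite X" "card X \<le> N" "g ` X \<subseteq> X" "x \<in> X" and c: "0 < c"
  shows "(g ^^ (fact N * c)) x = (g ^^ fact N) x"
proof -
  have in_X: "(g ^^ i) x \<in> X" for i
    using X(3,4) by (induction i) auto
  \<comment> \<open>The indices up to \<open>N\<close> are \<open>Suc N\<close> many, against at
    most \<open>N\<close> values.\<close>
  have "card ((\<lambda>i. (g ^^ i) x) ` {..N}) \<le> card X"
    using in_X by (intro card_mono X) auto
  then have "\<not> inj_on (\<lambda>i. (g ^^ i) x) {..N}"
    using X(2) by (intro pigeonhole) simp
  then obtain a b where ab: "a \<le> N" "b \<le> N" "(g ^^ a) x = (g ^^ b) x" "a \<noteq> b"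
    unfolding inj_on_def by auto
  obtain i j where ij: "i < j" "j \<le> N" "(g ^^ i) x = (g ^^ j) x"
    by (cases a b rule: linorder_cases) (use ab in auto)
  define p where "p = j - i"
  have p: "0 < p" "p \<le> N" "j = p + i" using ij by (auto simp: p_def)
  have shift: "(g ^^ (p + n)) x = (g ^^ n) x" if "i \<le> n" for n
  proof -
    from that obtain m where n: "n = m + i" by (metis le_add_diff_inverse2)
    have "(g ^^ (p + n)) x = (g ^^ m) ((g ^^ j) x)"
      unfolding n p(3) by (simp add: funpow_add[symmetric, THEN fun_cong, unfolded comp_def] ac_simps)
    also have "\<dots> = (g ^^ n) x"
      unfolding ij(3)[symmetric] n by (simp add: funpow_add)
    finally show ?thesis .
  qed
  have mult: "(g ^^ (m * p + fact N)) x = (g ^^ fact N) x" for m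
  proof (induction m)
    case (Suc m)
    have "i \<le> fact N" using ij fact_ge_self[of N] by linarith
    then show ?case using shift[of "m * p + fact N"] Suc by (simp add: add.assoc)
  qed simp
  obtain q where "fact N = p * q"
    using dvd_fact[of p N] p by (auto elim: dvdE)
  then have "fact N * c = ((c - 1) * q) * p + fact N"
    using c by (cases c) (simp_all add: algebra_simps)
  then show ?thesis using mult by simp
qed

lemma nfa_steps_append: "nfa_steps N Q (u @ v) = nfa_steps N (nfa_steps N Q u) v"
  by (induction u arbitrary: Q) simp_all

text \<open>Additivity in the set of states: the action of a word is described by the pairs of
  states that it links.\<close>

lemma nfa_steps_UN: "nfa_steps N Q w = (\<Union>q\<in>Q. nfa_steps N {q} w)"
proof (induction w arbitrary: Q)
  case (Cons a w)
  let ?succ = "\<lambda>Q. {q'. \<exists>q\<in>Q. (q, a, q') \<in> set (transitions N)}"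
  have "nfa_steps N Q (a # w) = (\<Union>q'\<in>?succ Q. nfa_steps N {q'} w)"
    unfolding nfa_steps.simps by (rule Cons.IH)
  also have "\<dots> = (\<Union>q\<in>Q. \<Union>q'\<in>?succ {q}. nfa_steps N {q'} w)" by blast
  also have "\<dots> = (\<Union>q\<in>Q. nfa_steps N {q} (a # w))"
    unfolding nfa_steps.simps by (intro SUP_cong refl Cons.IH[symmetric])
  finally show ?case .
qed auto

definition bounded_by :: "nat \<Rightarrow> nfa \<Rightarrow> bool" where
  "bounded_by c N \<longleftrightarrow> set (initial N) \<subseteq> {..<c} \<and> (\<forall>(q, a, q')\<in>set (transitions N). q' < c)"

lemma nfa_steps_bounded:
  "bounded_by c N \<Longrightarrow> Q \<subseteq> {..<c} \<Longrightarrow> nfa_steps N Q w \<subseteq> {..<c}"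
proof (induction w arbitrary: Q)
  case (Cons a w)
  then show ?case unfolding nfa_steps.simps by (intro Cons.IH) (auto simp: bounded_by_def)
qed simp

text \<open>The transition relations of \<open>w\<close> in all automata jointly, that is, its image
  in the transition monoid of their disjoint union. Start states are cut off at \<open>c\<close> to
  keep the set of triples finite.\<close>

definition behaviour :: "nat \<Rightarrow> nfa list \<Rightarrow> nat list \<Rightarrow> (nat \<times> nat \<times> nat) set" where
  "behaviour c Ns w =
     {(j, q, q'). j < length Ns \<and> q < c \<and> q' \<in> nfa_steps (Ns ! j) {q} w}"

text \<open>A behaviour is a set of triples below \<open>c\<close>, so there are at most
  \<open>2 ^ (c * c * c)\<close> of them and \<open>2 ^ (2 ^ (c * c * c))\<close> sets of
  behaviours; the factorial is that of \<open>funpow_fact_mult\<close>.\<close>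

definition stable_length_of :: "nat \<Rightarrow> nat" where
  "stable_length_of c = fact (2 ^ (2 ^ (c * c * c)))"

text \<open>Composition of relations; boundedness ensures that the intermediate states are below
  \<open>c\<close> too.\<close>

lemma behaviour_append:
  assumes "\<And>N. N \<in> set Ns \<Longrightarrow> bounded_by c N"
  shows "behaviour c Ns (u @ v) =
    {(j, q, q'). \<exists>p. (j, q, p) \<in> behaviour c Ns u \<and> (j, p, q') \<in> behaviour c Ns v}"
proof -
  have "q' \<in> nfa_steps (Ns ! j) {q} (u @ v) \<longleftrightarrow>
      (\<exists>p. p < c \<and> p \<in> nfa_steps (Ns ! j) {q} u \<and> q' \<in> nfa_steps (Ns ! j) {p} v)"
    if "j < length Ns" "q < c" for j q q'
  proof -
    have "nfa_steps (Ns ! j) {q} u \<subseteq> {..<c}"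
      using that assms by (intro nfa_steps_bounded) auto
    moreover have "q' \<in> nfa_steps (Ns ! j) {q} (u @ v) \<longleftrightarrow>
        (\<exists>p\<in>nfa_steps (Ns ! j) {q} u. q' \<in> nfa_steps (Ns ! j) {p} v)"
      unfolding nfa_steps_append by (subst nfa_steps_UN) simp
    ultimately show ?thesis by auto
  qed
  then show ?thesis unfolding behaviour_def by auto
qed

lemma stable_length_behaviour:
  assumes "finite A" "length Ns \<le> c" and bd: "\<And>N. N \<in> set Ns \<Longrightarrow> bounded_by c N"
  shows "stable_length (stable_length_of c) A (behaviour c Ns)"
proof
  let ?\<beta> = "behaviour c Ns"
  show "finite A" by fact
  show "0 < stable_length_of c" by (simp add: stable_length_of_def)
  show cong: "?\<beta> (u @ v) = ?\<beta> (u' @ v')" if "?\<beta> u = ?\<beta> u'" "?\<beta> v = ?\<beta> v'" for u u' v v'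
    using that by (simp add: behaviour_append[OF bd])
  fix e :: nat and b assume e: "0 < e" and b: "b \<in> lists A" "length b = stable_length_of c"
  define words where "words n = ?\<beta> ` {w \<in> lists A. length w = n}" for n
  \<comment> \<open>Extending all words by one letter composes their behaviours with those of
    letters, so the set of behaviours at length \<open>Suc n\<close> is computed from that at length
    \<open>n\<close>.\<close>
  define g where "g S = {{(j, q, q'). \<exists>p. (j, q, p) \<in> B \<and> (j, p, q') \<in> ?\<beta> [a]} | a B. a \<in> A \<and> B \<in> S}"
    for S :: "(nat \<times> nat \<times> nat) set set"
  define X where "X = Pow (Pow ({..<c} \<times> {..<c} \<times> {..<c}))"
  have \<beta>_X: "?\<beta> w \<in> Pow ({..<c} \<times> {..<c} \<times> {..<c})" for w
  proof -
    have "nfa_steps (Ns ! j) {q} w \<subseteq> {..<c}" if "j < length Ns" "q < c" for j q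
      using that bd by (intro nfa_steps_bounded) auto
    then show ?thesis using assms(2) unfolding behaviour_def by fastforce
  qed
  have words: "words n = (g ^^ n) (words 0)" for n
  proof (induction n)
    case (Suc n)
    have "words (Suc n) = g (words n)"
    proof (intro subset_antisym subsetI)
      fix B assume "B \<in> words (Suc n)"
      then obtain w where w: "w \<in> lists A" "length w = Suc n" "B = ?\<beta> w"
        unfolding words_def by blast
      then obtain u a where "w = u @ [a]" by (metis length_0_conv nat.distinct(1) rev_exhaust)
      then have "u \<in> lists A" "length u = n" "a \<in> A" "B = ?\<beta> (u @ [a])"
        using w by (simp_all add: snoc_in_lists_iff)
      moreover from this have "B = {(j, q, q'). \<exists>p. (j, q, p) \<in> ?\<beta> u \<and> (j, p, q') \<in> ?\<beta> [a]}"
        by (simp only: behaviour_append[OF bd])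
      ultimately show "B \<in> g (words n)"
        unfolding g_def words_def
        by (intro CollectI exI[of _ a] exI[of _ "?\<beta> u"] conjI) simp_all
    next
      fix B assume "B \<in> g (words n)"
      then obtain a B' where "a \<in> A" "B' \<in> words n"
        and B: "B = {(j, q, q'). \<exists>p. (j, q, p) \<in> B' \<and> (j, p, q') \<in> ?\<beta> [a]}"
        unfolding g_def by (elim CollectE exE conjE)
      then obtain u where u: "a \<in> A" "u \<in> lists A" "length u = n" "B' = ?\<beta> u"
        unfolding words_def by auto
      have "B = ?\<beta> (u @ [a])"
        unfolding B u(4) by (rule behaviour_append[OF bd, symmetric])
      then show "B \<in> words (Suc n)"
        unfolding words_def using u by (intro image_eqI[of _ _ "u @ [a]"]) (simp_all add: snoc_in_lists_iff)
    qed
    then show ?case using Suc by simp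
  qed simp
  have "words (stable_length_of c * e) = words (stable_length_of c)"
    unfolding words[of "stable_length_of c * e"] words[of "stable_length_of c"]
    unfolding stable_length_of_def
  proof (rule funpow_fact_mult[of X])
    show "finite X" by (simp add: X_def)
    show "card X \<le> 2 ^ 2 ^ (c * c * c)" by (simp add: X_def card_Pow card_cartesian_product mult.assoc)
    show "words 0 \<in> X" using \<beta>_X unfolding X_def words_def by blast
    show "g ` X \<subseteq> X"
    proof (rule image_subsetI)
      fix S assume S: "S \<in> X"
      have "B' \<subseteq> {..<c} \<times> {..<c} \<times> {..<c}" if "B' \<in> g S" for B'
      proof -
        from that obtain a B where B: "a \<in> A" "B \<in> S"
          "B' = {(j, q, q'). \<exists>p. (j, q, p) \<in> B \<and> (j, p, q') \<in> ?\<beta> [a]}"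
          unfolding g_def by blast
        then have "B \<subseteq> {..<c} \<times> {..<c} \<times> {..<c}" using S by (auto simp: X_def)
        then show ?thesis using \<beta>_X[of "[a]"] unfolding B(3) by fastforce
      qed
      then show "g S \<in> X" unfolding X_def by blast
    qed
    show "0 < e" by fact
  qed
  moreover have "?\<beta> b \<in> words (stable_length_of c)"
    unfolding words_def using b by blast
  ultimately have "?\<beta> b \<in> words (stable_length_of c * e)" by simp
  then show "\<exists>b'\<in>lists A. length b' = stable_length_of c * e \<and> ?\<beta> b' = ?\<beta> b"
    unfolding words_def by auto
qed

text \<open>Initial states lie below \<open>c\<close>, so the behaviour of a word determines the set
  of states that it reaches from them.\<close>

lemma nfa_lang_invariant:
  assumes "N \<in> set Ns" "bounded_by c N"
  shows "nfa_lang A N \<subseteq> lists A \<and> invariant_under A (behaviour c Ns) (nfa_lang A N)"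
proof
  show "nfa_lang A N \<subseteq> lists A" by (auto simp: nfa_lang_def)
  obtain j where j: "j < length Ns" "N = Ns ! j"
    using assms(1) by (auto simp: in_set_conv_nth)
  have "nfa_steps N (set (initial N)) w = {q'. \<exists>q\<in>set (initial N). (j, q, q') \<in> behaviour c Ns w}" for w
    using j assms(2) by (subst nfa_steps_UN) (auto simp: behaviour_def bounded_by_def)
  then show "invariant_under A (behaviour c Ns) (nfa_lang A N)"
    unfolding invariant_under_def nfa_lang_def by auto
qed

section \<open>Tagged automata\<close>

text \<open>Product with a counter modulo \<open>s\<close>, kept as second component of the state. A
  transition demands that the tag agrees with the counter, so incoherently tagged words die
  out.\<close>

definition tag_nfa :: "nat \<Rightarrow> nfa \<Rightarrow> nfa" where
  "tag_nfa s N = NFA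
     (map (\<lambda>q. prod_encode (q, 0)) (initial N))
     (concat (map (\<lambda>(q, a, q').
        map (\<lambda>i. (prod_encode (q, i), prod_encode (i, a), prod_encode (q', Suc i mod s))) [0..<s])
        (transitions N)))
     (concat (map (\<lambda>q. map (\<lambda>i. prod_encode (q, i)) [0..<s]) (final N)))"

lemma transitions_tag_nfa:
  "(p, x, p') \<in> set (transitions (tag_nfa s N)) \<longleftrightarrow>
    (\<exists>q a q' i. (q, a, q') \<in> set (transitions N) \<and> i < s \<and>
      p = prod_encode (q, i) \<and> x = prod_encode (i, a) \<and> p' = prod_encode (q', Suc i mod s))"
proof -
  have "set (transitions (tag_nfa s N)) = (\<Union>(q, a, q')\<in>set (transitions N).
      (\<lambda>i. (prod_encode (q, i), prod_encode (i, a), prod_encode (q', Suc i mod s))) ` {..<s})"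
    by (simp add: tag_nfa_def lessThan_atLeast0 split_def)
  then show ?thesis by auto
qed

lemma nfa_steps_tag_nfa:
  assumes s: "0 < s" and u: "u \<in> lists (tag_alphabet (len_mod s) A)"
  shows "nfa_steps (tag_nfa s N) (set (initial (tag_nfa s N))) u =
    (if u \<in> tag_by (len_mod s) ` lists A
     then {prod_encode (q, len_mod s u) | q.
       q \<in> nfa_steps N (set (initial N)) (map (snd \<circ> prod_decode) u)} else {})"
  using u
proof (induction u rule: rev_induct)
  case Nil
  have "[] \<in> tag_by (len_mod s) ` lists A" by (rule image_eqI[of _ _ "[]"]) simp_all
  then show ?case by (auto simp: tag_nfa_def)
next
  case (snoc x u)
  let ?untag = "map (snd \<circ> prod_decode)"
  obtain i a where x: "x = prod_encode (i, a)" "i < s" "a \<in> A"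
    using snoc.prems s by (auto simp: tag_alphabet_def snoc_in_lists_iff)
  have trans: "{q'. \<exists>q\<in>Q. (q, x, q') \<in> set (transitions (tag_nfa s N))} =
      {prod_encode (q', Suc i mod s) | q' q. prod_encode (q, i) \<in> Q \<and> (q, a, q') \<in> set (transitions N)}"
    for Q
    using x(2) by (auto simp: transitions_tag_nfa x(1))
  \<comment> \<open>Coherence is checked at the last letter: the prefix must be coherent and the new
    tag must be its length modulo \<open>s\<close>.\<close>
  have iff: "u @ [x] \<in> tag_by (len_mod s) ` lists A \<longleftrightarrow>
      u \<in> tag_by (len_mod s) ` lists A \<and> i = len_mod s u"
  proof
    assume "u @ [x] \<in> tag_by (len_mod s) ` lists A"
    then obtain v where v: "v \<in> lists A" "u @ [x] = tag_by (len_mod s) v" by blast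
    then obtain w b where "v = w @ [b]" by (cases v rule: rev_cases) auto
    then show "u \<in> tag_by (len_mod s) ` lists A \<and> i = len_mod s u"
      using v x(1) by (auto simp: snoc_in_lists_iff prod_encode_eq)
  next
    assume "u \<in> tag_by (len_mod s) ` lists A \<and> i = len_mod s u"
    then obtain w where "w \<in> lists A" "u = tag_by (len_mod s) w" "i = len_mod s w" by auto
    then show "u @ [x] \<in> tag_by (len_mod s) ` lists A"
      using x by (intro image_eqI[of _ _ "w @ [a]"]) (simp_all add: snoc_in_lists_iff)
  qed
  let ?Q = "nfa_steps (tag_nfa s N) (set (initial (tag_nfa s N))) u"
  let ?R = "nfa_steps N (set (initial N)) (?untag u)"
  have IH: "?Q = (if u \<in> tag_by (len_mod s) ` lists A
      then {prod_encode (q, len_mod s u) | q. q \<in> ?R} else {})"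
    using snoc by (simp add: snoc_in_lists_iff)
  have steps: "nfa_steps (tag_nfa s N) (set (initial (tag_nfa s N))) (u @ [x]) =
      {prod_encode (q', Suc i mod s) | q' q. prod_encode (q, i) \<in> ?Q \<and> (q, a, q') \<in> set (transitions N)}"
    by (simp only: nfa_steps_append nfa_steps.simps trans)
  have untag: "nfa_steps N (set (initial N)) (?untag (u @ [x])) =
      {q'. \<exists>q\<in>?R. (q, a, q') \<in> set (transitions N)}"
    by (simp add: nfa_steps_append x(1))
  have len: "len_mod s (u @ [x]) = Suc (len_mod s u) mod s"
    by (simp add: mod_Suc_eq)
  show ?case
    unfolding steps untag len iff IH by (auto simp: prod_encode_eq)
qed

lemma untag_tag_by [simp]: "map (snd \<circ> prod_decode) (tag_by f w) = w"
  by (rule nth_equalityI) (simp_all add: tag_by_def)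

lemma inj_tag_by: "inj (tag_by f)"
  by (rule injI) (rule tag_by_eqD(1))

lemma nfa_lang_tag_nfa:
  assumes s: "0 < s"
  shows "nfa_lang (tag_alphabet (len_mod s) A) (tag_nfa s N) = tag_by (len_mod s) ` nfa_lang A N"
proof -
  have final: "prod_encode (q, len_mod s u) \<in> set (final (tag_nfa s N)) \<longleftrightarrow> q \<in> set (final N)" for q and u :: "nat list"
    using s by (auto simp: tag_nfa_def prod_encode_eq image_iff)
  have "u \<in> nfa_lang (tag_alphabet (len_mod s) A) (tag_nfa s N) \<longleftrightarrow>
      u \<in> tag_by (len_mod s) ` nfa_lang A N" if u: "u \<in> lists (tag_alphabet (len_mod s) A)" for u
  proof (cases "u \<in> tag_by (len_mod s) ` lists A")
    case True
    then obtain w where w: "w \<in> lists A" "u = tag_by (len_mod s) w" by blast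
    have "u \<in> tag_by (len_mod s) ` nfa_lang A N \<longleftrightarrow> w \<in> nfa_lang A N"
      unfolding w(2) by (rule inj_image_mem_iff[OF inj_tag_by])
    moreover have "u \<in> nfa_lang (tag_alphabet (len_mod s) A) (tag_nfa s N) \<longleftrightarrow>
        nfa_steps N (set (initial N)) w \<inter> set (final N) \<noteq> {}"
    proof -
      have "nfa_steps (tag_nfa s N) (set (initial (tag_nfa s N))) u =
          {prod_encode (q, len_mod s u) | q. q \<in> nfa_steps N (set (initial N)) w}"
        using nfa_steps_tag_nfa[OF s u, of N] True w(2) by simp
      then show ?thesis
        unfolding nfa_lang_def using u final by auto
    qed
    ultimately show ?thesis using w(1) by (simp add: nfa_lang_def)
  next
    case False
    then have "u \<notin> tag_by (len_mod s) ` nfa_lang A N" by (auto simp: nfa_lang_def)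
    moreover have "u \<notin> nfa_lang (tag_alphabet (len_mod s) A) (tag_nfa s N)"
      unfolding nfa_lang_def using False by (simp add: nfa_steps_tag_nfa[OF s u])
    ultimately show ?thesis by simp
  qed
  moreover have "tag_by (len_mod s) ` nfa_lang A N \<subseteq> lists (tag_alphabet (len_mod s) A)"
    using tag_by_in_lists by (auto simp: nfa_lang_def)
  moreover have "nfa_lang (tag_alphabet (len_mod s) A) (tag_nfa s N) \<subseteq> lists (tag_alphabet (len_mod s) A)"
    by (auto simp: nfa_lang_def)
  ultimately show ?thesis by blast
qed

section \<open>The reductions\<close>

definition tag_letters :: "nat \<Rightarrow> nat list \<Rightarrow> nat list" where
  "tag_letters s A = concat (map (\<lambda>i. map (\<lambda>a. prod_encode (i, a)) A) [0..<s])"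

text \<open>The code of the input exceeds or equals all relevant sizes, so no separate bound has to
  be computed. The two extra units make room for the number of automata, here one more than the
  length of \<open>Ns\<close> and in separation two.\<close>

definition covering_reduction :: "covering_input \<Rightarrow> covering_input" where
  "covering_reduction = (\<lambda>(A, N, Ns).
     let s = stable_length_of (Suc (Suc (covering_code (A, N, Ns))))
     in (tag_letters s A, tag_nfa s N, map (tag_nfa s) Ns))"

definition separation_reduction :: "separation_input \<Rightarrow> separation_input" where
  "separation_reduction = (\<lambda>(A, M, N).
     let s = stable_length_of (Suc (Suc (separation_code (A, M, N))))
     in (tag_letters s A, tag_nfa s M, tag_nfa s N))"

lemma set_tag_letters:
  assumes "0 < s"
  shows "set (tag_letters s A) = tag_alphabet (len_mod s) (set A)"
proof (cases A)
  case (Cons a B)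
  \<comment> \<open>A nonempty alphabet has words of every length, so all residues occur as tags;
    over the empty alphabet both sides are empty.\<close>
  have "i \<in> len_mod s ` lists (set A)" if "i < s" for i
    using that Cons by (intro image_eqI[of _ _ "replicate i a"]) (auto simp: in_lists_conv_set)
  then have "len_mod s ` lists (set A) = {..<s}"
    using assms by auto
  then show ?thesis by (auto simp: tag_letters_def tag_alphabet_def)
qed (simp add: tag_letters_def tag_alphabet_def)

text \<open>\<open>tag_nfa\<close> on codes. The conditional is \<open>Suc i mod s\<close> for
  \<open>i < s\<close>, in the shape of a test for 0 that \<open>total_recursive_If\<close>
  handles.\<close>

definition tag_nfa_code :: "nat \<Rightarrow> nat \<Rightarrow> nat" where
  "tag_nfa_code s n = prod_encode
     (list_encode (map (\<lambda>q. prod_encode (q, 0)) (list_decode (pfst n))),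
      prod_encode
       (list_encode (concat (map (\<lambda>t. map (\<lambda>i. prod_encode (prod_encode (pfst t, i),
            prod_encode (prod_encode (i, pfst (psnd t)),
              prod_encode (psnd (psnd t), if s - Suc i = 0 then 0 else Suc i)))) [0..<s])
          (list_decode (pfst (psnd n))))),
        list_encode (concat (map (\<lambda>q. map (\<lambda>i. prod_encode (q, i)) [0..<s])
          (list_decode (psnd (psnd n)))))))"

lemma tag_nfa_code_nfa_code: "tag_nfa_code s (nfa_code N) = nfa_code (tag_nfa s N)"
proof -
  have "map (\<lambda>i. G i (if s - Suc i = 0 then 0 else Suc i)) [0..<s] =
      map (\<lambda>i. G i (Suc i mod s)) [0..<s]" for G :: "nat \<Rightarrow> nat \<Rightarrow> nat"
    by (intro map_cong refl arg_cong[of _ _ "G _"]) (auto simp: mod_Suc)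
  note nxt = this[of "\<lambda>i j. prod_encode (prod_encode (_, i), prod_encode (prod_encode (i, _), prod_encode (_, j)))"]
  have "triple_code t = prod_encode (fst t, prod_encode (fst (snd t), snd (snd t)))" for t
    by (cases t) simp
  then show ?thesis
    by (cases N) (simp only: tag_nfa_code_def nxt, simp add: tag_nfa_def map_concat comp_def split_def)
qed

lemma total_recursive_stable_length_of:
  assumes "total_recursive f"
  shows "total_recursive (\<lambda>x. stable_length_of (f x))"
  unfolding stable_length_of_def by (intro total_recursive_intros assms)

lemma list_recursive_tag_letters:
  assumes "total_recursive f" "list_recursive L"
  shows "list_recursive (\<lambda>x. tag_letters (f x) (L x))"
  unfolding tag_letters_def
  by (intro total_recursive_intros total_recursive_comp[OF assms(2)] assms)

lemma total_recursive_tag_nfa_code: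
  assumes "total_recursive f" "total_recursive g"
  shows "total_recursive (\<lambda>x. tag_nfa_code (f x) (g x))"
proof -
  have "total_recursive (\<lambda>x. tag_nfa_code (pfst x) (psnd x))"
    unfolding tag_nfa_code_def by (intro total_recursive_intros)
  from total_recursive_comp[OF this, of "\<lambda>x. prod_encode (f x, g x)"] assms show ?thesis
    by (simp add: total_recursive_intros)
qed

lemma covering_reduction_recursive:
  "\<exists>g. total_recursive g \<and> (\<forall>x. g (covering_code x) = covering_code (covering_reduction x))"
proof -
  let ?s = "\<lambda>x. stable_length_of (Suc (Suc x))"
  define g where "g x = prod_encode (list_encode (tag_letters (?s x) (list_decode (pfst x))),
    prod_encode (tag_nfa_code (?s x) (pfst (psnd x)),
      list_encode (map (\<lambda>n. tag_nfa_code (?s x) n) (list_decode (psnd (psnd x))))))" for x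
  have "total_recursive g"
    unfolding g_def
    by (intro total_recursive_stable_length_of list_recursive_tag_letters
        total_recursive_tag_nfa_code total_recursive_intros)
  moreover have "g (covering_code x) = covering_code (covering_reduction x)" for x
    by (cases x) (simp add: g_def covering_reduction_def Let_def tag_nfa_code_nfa_code comp_def)
  ultimately show ?thesis by blast
qed

lemma separation_reduction_recursive:
  "\<exists>g. total_recursive g \<and> (\<forall>x. g (separation_code x) = separation_code (separation_reduction x))"
proof -
  let ?s = "\<lambda>x. stable_length_of (Suc (Suc x))"
  define g where "g x = prod_encode (list_encode (tag_letters (?s x) (list_decode (pfst x))),
    prod_encode (tag_nfa_code (?s x) (pfst (psnd x)), tag_nfa_code (?s x) (psnd (psnd x))))" for x
  have "total_recursive g"
    unfolding g_def
    by (intro total_recursive_stable_length_of list_recursive_tag_letters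
        total_recursive_tag_nfa_code total_recursive_intros)
  moreover have "g (separation_code x) = separation_code (separation_reduction x)" for x
    by (cases x) (simp add: g_def separation_reduction_def Let_def tag_nfa_code_nfa_code)
  ultimately show ?thesis by blast
qed

lemma mem_less_list_encode: "x \<in> set xs \<Longrightarrow> x < list_encode xs"
proof (induction xs)
  case (Cons y xs)
  then show ?case
    using le_prod_encode_1[of y "list_encode xs"] le_prod_encode_2[of "list_encode xs" y]
    by (fastforce simp: less_Suc_eq_le)
qed simp

text \<open>Pair codes dominate their components and list codes strictly exceed their members, so
  every initial or target state is below the code of the automaton.\<close>

lemma bounded_by_nfa_code:
  assumes "nfa_code N \<le> c"
  shows "bounded_by c N"
proof -
  obtain I T F where N: "N = NFA I T F" by (cases N)
  have I: "list_encode I \<le> nfa_code N" and T: "list_encode (map triple_code T) \<le> nfa_code N"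
    unfolding N using le_prod_encode_1 order_trans[OF le_prod_encode_1 le_prod_encode_2] by simp_all
  have "q' < c" if "(q, a, q') \<in> set T" for q a q'
  proof -
    have "q' \<le> triple_code (q, a, q')"
      using le_prod_encode_2[of q' a] le_prod_encode_2[of "prod_encode (a, q')" q] by simp
    also have "\<dots> < list_encode (map triple_code T)"
      using that by (intro mem_less_list_encode) force
    finally show ?thesis using T assms by simp
  qed
  moreover have "q < c" if "q \<in> set I" for q
    using mem_less_list_encode[OF that] I assms by simp
  ultimately show ?thesis unfolding bounded_by_def N by auto
qed

theorem theorem5p1:
  fixes C :: lang_class
  assumes "positive_variety C"
  shows "effectively_reduces covering_code
           (covering_problem ((C \<circ>\<^sub>e SU) \<circ>\<^sub>e MOD)) (covering_problem (C \<circ>\<^sub>e SU))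
       \<and> effectively_reduces separation_code
           (separation_problem ((C \<circ>\<^sub>e SU) \<circ>\<^sub>e MOD)) (separation_problem (C \<circ>\<^sub>e SU))"
proof
  have "covering_problem ((C \<circ>\<^sub>e SU) \<circ>\<^sub>e MOD) x \<longleftrightarrow> covering_problem (C \<circ>\<^sub>e SU) (covering_reduction x)" for x
  proof -
    obtain A N Ns where x: "x = (A, N, Ns)" by (cases x)
    define c where "c = Suc (Suc (covering_code x))"
    define s where "s = stable_length_of c"
    have "list_encode (map nfa_code Ns) \<le> covering_code x" "nfa_code N \<le> covering_code x"
      unfolding x using order_trans[OF le_prod_encode_2 le_prod_encode_2]
        order_trans[OF le_prod_encode_1 le_prod_encode_2] by simp_all
    moreover from this have "nfa_code M \<le> covering_code x" if "M \<in> set (N # Ns)" for M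
      using that mem_less_list_encode[of "nfa_code M" "map nfa_code Ns"] by fastforce
    ultimately have bd: "bounded_by c M" if "M \<in> set (N # Ns)" for M
      using that by (intro bounded_by_nfa_code) (auto simp: c_def intro: le_SucI)
    have "length (N # Ns) \<le> c"
      using length_le_list_encode[of "map nfa_code Ns"]
        \<open>list_encode (map nfa_code Ns) \<le> covering_code x\<close> by (simp add: c_def)
    \<comment> \<open>The joint behaviour of all input automata makes every input language saturated
      for one and the same \<open>s\<close>.\<close>
    then interpret stable_length s "set A" "behaviour c (N # Ns)"
      unfolding s_def using bd by (intro stable_length_behaviour) simp_all
    have sat: "saturated (nfa_lang (set A) M)" if "M \<in> set (N # Ns)" for M
      unfolding saturated_def using that bd by (intro nfa_lang_invariant)
    have red: "covering_reduction (A, N, Ns) = (tag_letters s A, tag_nfa s N, map (tag_nfa s) Ns)"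
      unfolding covering_reduction_def s_def c_def x by (simp only: prod.case Let_def)
    have "coverable ((C \<circ>\<^sub>e SU) \<circ>\<^sub>e MOD) (set A) (nfa_lang (set A) N) (mset (map (nfa_lang (set A)) Ns)) \<longleftrightarrow>
        coverable (C \<circ>\<^sub>e SU) A' (\<tau> ` nfa_lang (set A) N)
          (image_mset ((`) \<tau>) (mset (map (nfa_lang (set A)) Ns)))"
      by (rule coverable_iff[OF assms]) (use sat in auto)
    then show ?thesis
      unfolding x red
      by (simp add: set_tag_letters nfa_lang_tag_nfa s_pos comp_def multiset.map_comp)
  qed
  then show "effectively_reduces covering_code
      (covering_problem ((C \<circ>\<^sub>e SU) \<circ>\<^sub>e MOD)) (covering_problem (C \<circ>\<^sub>e SU))"
    unfolding effectively_reduces_def using covering_reduction_recursive by blast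
next
  have "separation_problem ((C \<circ>\<^sub>e SU) \<circ>\<^sub>e MOD) x \<longleftrightarrow>
      separation_problem (C \<circ>\<^sub>e SU) (separation_reduction x)" for x
  proof -
    obtain A M N where x: "x = (A, M, N)" by (cases x)
    define c where "c = Suc (Suc (separation_code x))"
    define s where "s = stable_length_of c"
    have "nfa_code M \<le> separation_code x" "nfa_code N \<le> separation_code x"
      unfolding x using order_trans[OF le_prod_encode_2 le_prod_encode_2]
        order_trans[OF le_prod_encode_1 le_prod_encode_2] by simp_all
    then have bd: "bounded_by c K" if "K \<in> set [M, N]" for K
      using that by (intro bounded_by_nfa_code) (auto simp: c_def)
    have "length [M, N] \<le> c" by (simp add: c_def)
    then interpret stable_length s "set A" "behaviour c [M, N]"
      unfolding s_def using bd by (intro stable_length_behaviour) simp_all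
    have sat: "saturated (nfa_lang (set A) K)" if "K \<in> set [M, N]" for K
      unfolding saturated_def using that bd by (intro nfa_lang_invariant)
    have red: "separation_reduction (A, M, N) = (tag_letters s A, tag_nfa s M, tag_nfa s N)"
      unfolding separation_reduction_def s_def c_def x by (simp only: prod.case Let_def)
    have "separable ((C \<circ>\<^sub>e SU) \<circ>\<^sub>e MOD) (set A) (nfa_lang (set A) M) (nfa_lang (set A) N) \<longleftrightarrow>
        separable (C \<circ>\<^sub>e SU) A' (\<tau> ` nfa_lang (set A) M) (\<tau> ` nfa_lang (set A) N)"
      by (rule separable_iff[OF assms]) (use sat in auto)
    then show ?thesis
      unfolding x red by (simp add: set_tag_letters nfa_lang_tag_nfa s_pos)
  qed
  then show "effectively_reduces separation_code
      (separation_problem ((C \<circ>\<^sub>e SU) \<circ>\<^sub>e MOD)) (separation_problem (C \<circ>\<^sub>e SU))"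
    unfolding effectively_reduces_def using separation_reduction_recursive by blast
qed

end
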